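(* Let $\mathfrak{N}=(N,\rho,\alpha,G)$ and $\mathfrak{M}=(M,\varphi,\beta,G)$ be $W^*$-dynamical systems, let $\mathfrak{B}$ be a common subsystem of $\mathfrak{N}$ and $\mathfrak{M}$, and let $\Phi\in J_m(\mathfrak{N},\mathfrak{M})$. Then $\Phi\in J_{\mathfrak{B}}(\mathfrak{N},\mathfrak{M})$ if and only if $\Phi^*\in J_{\mathfrak{B}}(\mathfrak{M},\mathfrak{N})$.
   Context: A $W^*$-dynamical system is a tuple $\mathfrak{N}=(N,\rho,\alpha,G)$ with $N$ a von Neumann algebra with separable predual, $\rho$ a faithful normal state on $N$, and $\alpha$ a strongly continuous action of a separable locally compact group $G$ on $N$ by $\rho$-preserving automorphisms. $(\sigma_t^\rho)$ is the modular automorphism group of $\rho$. $J_m(\mathfrak{N},\mathfrak{M})$ is the set of normal unital completely positive (ucp) maps $\Phi:N\to M$ with $\varphi\circ\Phi=\rho$, $\sigma_t^\varphi\circ\Phi=\Phi\circ\sigma_t^\rho$ for all $t\in\mathbb{R}$, and $\beta_g\circ\Phi=\Phi\circ\alpha_g$ for all $g\in G$. For such $\Phi$, its adjoint $\Phi^*:M\to N$ is the normal ucp map determined by $\rho(\Phi^*(y)x)=\varphi(y\Phi(x))$ for all $x\in N$, $y\in M$. A common subsystem of $\mathfrak{N}$ and $\mathfrak{M}$ is a system $\mathfrak{B}=(B,\mu,\gamma,G)$ together with injective $*$-homomorphisms $\iota_N\in J_m(\mathfrak{B},\mathfrak{N})$, $\iota_M\in J_m(\mathfrak{B},\mathfrak{M})$.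 $J_{\mathfrak{B}}(\mathfrak{N},\mathfrak{M})$ is the set of $\Phi\in J_m(\mathfrak{N},\mathfrak{M})$ whose restriction to $\iota_N(B)$ is $\iota_M\circ\iota_N^{-1}$; $J_{\mathfrak{B}}(\mathfrak{M},\mathfrak{N})$ is the set of $\Psi\in J_m(\mathfrak{M},\mathfrak{N})$ whose restriction to $\iota_M(B)$ is $\iota_N\circ\iota_M^{-1}$. *)

theory Defs
  imports "HOL-Analysis.Analysis"
begin

section \<open>Complex Hilbert spaces and their operators\<close>

text \<open>The inner product is linear in the second variable. Positive definiteness follows from
  \<open>norm_eq_sqrt_cinner\<close>, since \<open>sqrt\<close> of a negative number is negative.\<close>

class chilbert_space = banach +
  fixes scaleC :: "complex \<Rightarrow> 'a \<Rightarrow> 'a" (infixr "*\<^sub>C" 75)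
    and cinner :: "'a \<Rightarrow> 'a \<Rightarrow> complex"
  assumes scaleC_add_right: "c *\<^sub>C (x + y) = c *\<^sub>C x + c *\<^sub>C y"
    and scaleC_add_left: "(c + d) *\<^sub>C x = c *\<^sub>C x + d *\<^sub>C x"
    and scaleC_scaleC: "c *\<^sub>C (d *\<^sub>C x) = (c * d) *\<^sub>C x"
    and scaleC_of_real: "complex_of_real r *\<^sub>C x = r *\<^sub>R x"
    and cinner_commute: "cinner x y = cnj (cinner y x)"
    and cinner_add_right: "cinner x (y + z) = cinner x y + cinner x z"
    and cinner_scaleC_right: "cinner x (c *\<^sub>C y) = c * cinner x y"
    and norm_eq_sqrt_cinner: "norm x = sqrt (Re (cinner x x))"

instantiation complex :: chilbert_space
begin

definition scaleC_complex :: "complex \<Rightarrow> complex \<Rightarrow> complex" where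
  "scaleC_complex c x = c * x"

definition cinner_complex :: "complex \<Rightarrow> complex \<Rightarrow> complex" where
  "cinner_complex x y = cnj x * y"

instance
  by standard
    (auto simp: scaleC_complex_def cinner_complex_def algebra_simps scaleR_conv_of_real
      cmod_def power2_eq_square)

end

lemma cinner_scaleC_left: "cinner (c *\<^sub>C x) y = cnj c * cinner x (y :: 'a::chilbert_space)"
  by (metis cinner_commute cinner_scaleC_right complex_cnj_mult)

lemma norm_scaleC: "norm (c *\<^sub>C x) = cmod c * norm (x :: 'a::chilbert_space)"
proof -
  have "cinner (c *\<^sub>C x) (c *\<^sub>C x) = (c * cnj c) * cinner x x"
    by (simp add: cinner_scaleC_left cinner_scaleC_right mult_ac)
  also have "\<dots> = complex_of_real ((cmod c)\<^sup>2) * cinner x x"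
    by (simp only: complex_norm_square)
  finally have "Re (cinner (c *\<^sub>C x) (c *\<^sub>C x)) = (cmod c)\<^sup>2 * Re (cinner x x)"
    by simp
  then show ?thesis
    using norm_eq_sqrt_cinner[of "c *\<^sub>C x"] norm_eq_sqrt_cinner[of x]
    by (simp add: real_sqrt_mult)
qed

lemma bounded_linear_scaleC: "bounded_linear (\<lambda>x :: 'a::chilbert_space. c *\<^sub>C x)"
proof (rule bounded_linear_intro[where K = "cmod c"])
  show "c *\<^sub>C (r *\<^sub>R x) = r *\<^sub>R (c *\<^sub>C x)" for r and x :: 'a
    by (metis scaleC_of_real scaleC_scaleC mult.commute)
qed (simp_all add: scaleC_add_right norm_scaleC mult.commute)

text \<open>Operators are elements of the library type of bounded \<^emph>\<open>real\<close>-linear maps;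
  \<open>bounded_ops\<close> is the algebra \<open>B(H)\<close> of the complex-linear ones among them.\<close>

type_synonym 'h op = "'h \<Rightarrow>\<^sub>L 'h"

definition bounded_ops :: "('h::chilbert_space) op set" where
  "bounded_ops = {T. \<forall>c \<xi>. blinfun_apply T (c *\<^sub>C \<xi>) = c *\<^sub>C blinfun_apply T \<xi>}"

lift_definition scaleC_op :: "complex \<Rightarrow> ('h::chilbert_space) op \<Rightarrow> 'h op"
  is "\<lambda>c T \<xi>. c *\<^sub>C T \<xi>"
  by (rule bounded_linear_compose[OF bounded_linear_scaleC])

definition is_adj :: "('h::chilbert_space) op \<Rightarrow> 'h op \<Rightarrow> bool" where
  "is_adj T T' \<longleftrightarrow>
    (\<forall>\<xi> \<eta>. cinner (blinfun_apply T' \<xi>) \<eta> = cinner \<xi> (blinfun_apply T \<eta>))"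

definition adj :: "('h::chilbert_space) op \<Rightarrow> 'h op" where
  "adj T = (THE T'. is_adj T T')"


section \<open>Von Neumann algebras\<close>

definition commutant :: "('h::chilbert_space) op set \<Rightarrow> 'h op set" where
  "commutant S = {T \<in> bounded_ops. \<forall>x\<in>S. T o\<^sub>L x = x o\<^sub>L T}"

definition von_neumann_algebra :: "('h::chilbert_space) op set \<Rightarrow> bool" where
  "von_neumann_algebra N \<longleftrightarrow>
    N \<subseteq> bounded_ops \<and> (\<forall>x\<in>N. \<exists>x'\<in>N. is_adj x x') \<and> commutant (commutant N) = N"

definition vector_functional ::
    "(nat \<Rightarrow> 'h) \<Rightarrow> (nat \<Rightarrow> 'h) \<Rightarrow> ('h::chilbert_space) op \<Rightarrow> complex" where
  "vector_functional \<xi> \<eta> x = (\<Sum>n. cinner (\<xi> n) (blinfun_apply x (\<eta> n)))"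

definition vector_functionals :: "(('h::chilbert_space) op \<Rightarrow> complex) set" where
  "vector_functionals = {vector_functional \<xi> \<eta> | \<xi> \<eta>.
     summable (\<lambda>n. (norm (\<xi> n))\<^sup>2) \<and> summable (\<lambda>n. (norm (\<eta> n))\<^sup>2)}"

text \<open>The coarsest topology on \<open>N\<close> making all \<open>vector_functionals\<close> continuous.\<close>

definition ultraweak :: "('h::chilbert_space) op set \<Rightarrow> 'h op topology" where
  "ultraweak N = pullback_topology N (\<lambda>x. restrict (\<lambda>\<omega>. \<omega> x) vector_functionals)
     (product_topology (\<lambda>_. euclidean) vector_functionals)"

definition linear_functional_on :: "('h::chilbert_space) op set \<Rightarrow> ('h op \<Rightarrow> complex) \<Rightarrow> bool" where
  "linear_functional_on N \<omega> \<longleftrightarrow>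
    (\<forall>x\<in>N. \<forall>y\<in>N. \<omega> (x + y) = \<omega> x + \<omega> y) \<and> (\<forall>c. \<forall>x\<in>N. \<omega> (scaleC_op c x) = c * \<omega> x)"

definition predual :: "('h::chilbert_space) op set \<Rightarrow> ('h op \<Rightarrow> complex) set" where
  "predual N = {\<omega>. linear_functional_on N \<omega> \<and> continuous_map (ultraweak N) euclidean \<omega>}"

text \<open>Separability for the norm \<open>sup {|\<omega> x|. x \<in> N, norm x \<le> 1}\<close> of the predual.\<close>

definition separable_predual :: "('h::chilbert_space) op set \<Rightarrow> bool" where
  "separable_predual N \<longleftrightarrow>
    (\<exists>D \<subseteq> predual N. countable D \<and>
      (\<forall>\<omega>\<in>predual N. \<forall>e>0. \<exists>\<delta>\<in>D. \<forall>x\<in>N. norm x \<le> 1 \<longrightarrow> cmod (\<omega> x - \<delta> x) \<le> e))"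

definition faithful_normal_state :: "('h::chilbert_space) op set \<Rightarrow> ('h op \<Rightarrow> complex) \<Rightarrow> bool" where
  "faithful_normal_state N \<rho> \<longleftrightarrow>
    \<rho> \<in> predual N \<and> \<rho> id_blinfun = 1 \<and>
    (\<forall>x\<in>N. \<rho> (adj x o\<^sub>L x) \<in> \<real>\<^sub>\<ge>\<^sub>0) \<and>
    (\<forall>x\<in>N. \<rho> (adj x o\<^sub>L x) = 0 \<longrightarrow> x = 0)"


section \<open>Maps between von Neumann algebras\<close>

text \<open>A map \<open>N \<rightarrow> M\<close> is a function on operators whose values off \<open>N\<close> are irrelevant.\<close>

definition linear_map_on ::
    "('h::chilbert_space) op set \<Rightarrow> ('k::chilbert_space) op set \<Rightarrow> ('h op \<Rightarrow> 'k op) \<Rightarrow> bool" where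
  "linear_map_on N M \<Phi> \<longleftrightarrow>
    \<Phi> \<in> N \<rightarrow> M \<and>
    (\<forall>x\<in>N. \<forall>y\<in>N. \<Phi> (x + y) = \<Phi> x + \<Phi> y) \<and>
    (\<forall>c. \<forall>x\<in>N. \<Phi> (scaleC_op c x) = scaleC_op c (\<Phi> x))"

definition star_hom ::
    "('h::chilbert_space) op set \<Rightarrow> ('k::chilbert_space) op set \<Rightarrow> ('h op \<Rightarrow> 'k op) \<Rightarrow> bool" where
  "star_hom N M \<Phi> \<longleftrightarrow>
    linear_map_on N M \<Phi> \<and>
    (\<forall>x\<in>N. \<forall>y\<in>N. \<Phi> (x o\<^sub>L y) = \<Phi> x o\<^sub>L \<Phi> y) \<and>
    (\<forall>x\<in>N. is_adj (\<Phi> x) (\<Phi> (adj x)))"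

text \<open>Positivity of the matrix \<open>(X i j)\<close>, \<open>i, j < n\<close>, as an operator on \<open>H\<^sup>n\<close>.\<close>

definition positive_matrix :: "nat \<Rightarrow> (nat \<Rightarrow> nat \<Rightarrow> ('h::chilbert_space) op) \<Rightarrow> bool" where
  "positive_matrix n X \<longleftrightarrow>
    (\<forall>\<xi> :: nat \<Rightarrow> 'h.
      (\<Sum>i<n. \<Sum>j<n. cinner (\<xi> i) (blinfun_apply (X i j) (\<xi> j))) \<in> \<real>\<^sub>\<ge>\<^sub>0)"

definition completely_positive ::
    "('h::chilbert_space) op set \<Rightarrow> ('h op \<Rightarrow> ('k::chilbert_space) op) \<Rightarrow> bool" where
  "completely_positive N \<Phi> \<longleftrightarrow>
    (\<forall>n X. (\<forall>i<n. \<forall>j<n. X i j \<in> N) \<longrightarrow> positive_matrix n X \<longrightarrow>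
      positive_matrix n (\<lambda>i j. \<Phi> (X i j)))"

definition normal_ucp ::
    "('h::chilbert_space) op set \<Rightarrow> ('k::chilbert_space) op set \<Rightarrow> ('h op \<Rightarrow> 'k op) \<Rightarrow> bool" where
  "normal_ucp N M \<Phi> \<longleftrightarrow>
    linear_map_on N M \<Phi> \<and> \<Phi> id_blinfun = id_blinfun \<and> completely_positive N \<Phi> \<and>
    continuous_map (ultraweak N) (ultraweak M) \<Phi>"

text \<open>\<open>group_add\<close> is not assumed commutative, so the additively written \<open>'g\<close> is an arbitrary
  group.\<close>

definition automorphism_action ::
    "('h::chilbert_space) op set \<Rightarrow> ('g::group_add \<Rightarrow> 'h op \<Rightarrow> 'h op) \<Rightarrow> bool" where
  "automorphism_action N \<alpha> \<longleftrightarrow>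
    (\<forall>g. star_hom N N (\<alpha> g) \<and> bij_betw (\<alpha> g) N N) \<and>
    (\<forall>x\<in>N. \<alpha> 0 x = x) \<and>
    (\<forall>g h. \<forall>x\<in>N. \<alpha> (g + h) x = \<alpha> g (\<alpha> h x))"


section \<open>Modular automorphism groups\<close>

definition gns_triple ::
    "('h::chilbert_space) op set \<Rightarrow> ('h op \<Rightarrow> complex) \<Rightarrow>
     ('h op \<Rightarrow> ('k::chilbert_space) op) \<Rightarrow> 'k \<Rightarrow> bool" where
  "gns_triple N \<rho> \<pi> \<Omega> \<longleftrightarrow>
    star_hom N bounded_ops \<pi> \<and>
    (\<forall>x\<in>N. \<rho> x = cinner \<Omega> (blinfun_apply (\<pi> x) \<Omega>)) \<and>
    closure ((\<lambda>x. blinfun_apply (\<pi> x) \<Omega>) ` N) = UNIV"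

text \<open>Unbounded operators are given by their graphs. \<open>tomita_operator\<close> is the closure \<open>S\<close> of
  \<open>\<pi>(x)\<Omega> \<mapsto> \<pi>(x\<^sup>*)\<Omega>\<close>; the adjoint of an antilinear operator is determined by
  \<open>\<langle>S \<xi>, \<eta>\<rangle> = \<langle>S\<^sup>* \<eta>, \<xi>\<rangle>\<close>; and the modular operator is \<open>\<Delta> = S\<^sup>* S\<close>.\<close>

definition tomita_operator ::
    "('h::chilbert_space) op set \<Rightarrow> ('h op \<Rightarrow> ('k::chilbert_space) op) \<Rightarrow> 'k \<Rightarrow> ('k \<times> 'k) set" where
  "tomita_operator N \<pi> \<Omega> =
    closure {(blinfun_apply (\<pi> x) \<Omega>, blinfun_apply (\<pi> (adj x)) \<Omega>) | x. x \<in> N}"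

definition antilinear_adjoint :: "(('k::chilbert_space) \<times> 'k) set \<Rightarrow> ('k \<times> 'k) set" where
  "antilinear_adjoint S = {(\<eta>, \<zeta>). \<forall>(\<xi>, \<xi>')\<in>S. cinner \<xi>' \<eta> = cinner \<zeta> \<xi>}"

definition modular_operator ::
    "('h::chilbert_space) op set \<Rightarrow> ('h op \<Rightarrow> ('k::chilbert_space) op) \<Rightarrow> 'k \<Rightarrow> ('k \<times> 'k) set" where
  "modular_operator N \<pi> \<Omega> =
    tomita_operator N \<pi> \<Omega> O antilinear_adjoint (tomita_operator N \<pi> \<Omega>)"

definition projection_valued_measure :: "(real set \<Rightarrow> ('k::chilbert_space) op) \<Rightarrow> bool" where
  "projection_valued_measure E \<longleftrightarrow>
    (\<forall>A\<in>sets borel. E A \<in> bounded_ops \<and> is_adj (E A) (E A)) \<and>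
    E UNIV = id_blinfun \<and>
    (\<forall>A\<in>sets borel. \<forall>B\<in>sets borel. E (A \<inter> B) = E A o\<^sub>L E B) \<and>
    (\<forall>A :: nat \<Rightarrow> real set. range A \<subseteq> sets borel \<longrightarrow> disjoint_family A \<longrightarrow>
      (\<forall>\<xi>. (\<lambda>n. blinfun_apply (E (A n)) \<xi>) sums blinfun_apply (E (\<Union>n. A n)) \<xi>))"

definition spectral_measure :: "(real set \<Rightarrow> ('k::chilbert_space) op) \<Rightarrow> 'k \<Rightarrow> real measure" where
  "spectral_measure E \<xi> =
    measure_of UNIV (sets borel) (\<lambda>A. ennreal (Re (cinner \<xi> (blinfun_apply (E A) \<xi>))))"

text \<open>For the graph \<open>T\<close> of a linear operator: \<open>T = \<integral> f dE\<close>. The off-diagonal matrix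
  coefficients of \<open>T\<close> are determined by the diagonal ones through polarization.\<close>

definition is_spectral_integral ::
    "(real set \<Rightarrow> 'k op) \<Rightarrow> (real \<Rightarrow> complex) \<Rightarrow> (('k::chilbert_space) \<times> 'k) set \<Rightarrow> bool" where
  "is_spectral_integral E f T \<longleftrightarrow>
    Domain T = {\<xi>. integrable (spectral_measure E \<xi>) (\<lambda>l. (cmod (f l))\<^sup>2)} \<and>
    (\<forall>(\<xi>, \<zeta>)\<in>T. cinner \<xi> \<zeta> = integral\<^sup>L (spectral_measure E \<xi>) f)"

text \<open>\<open>E\<close> is the spectral resolution of \<open>\<Delta>\<close> and \<open>U t = \<Delta>\<^sup>i\<^sup>t\<close>; since \<open>\<Delta>\<close> is positive
  and injective, \<open>E\<close> lives on \<open>l > 0\<close>, where \<open>cis (t * ln l)\<close> is \<open>l\<^sup>i\<^sup>t\<close>. The group \<open>\<sigma>\<close> is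
  given by \<open>\<pi>(\<sigma>\<^sub>t(x)) = \<Delta>\<^sup>i\<^sup>t \<pi>(x) \<Delta>\<^sup>-\<^sup>i\<^sup>t\<close>; by Tomita's theorem such a \<open>\<sigma>\<close> always exists.\<close>

definition modular_automorphism_group ::
    "('h::chilbert_space) op set \<Rightarrow> ('h op \<Rightarrow> ('k::chilbert_space) op) \<Rightarrow> 'k \<Rightarrow>
     (real \<Rightarrow> 'h op \<Rightarrow> 'h op) \<Rightarrow> bool" where
  "modular_automorphism_group N \<pi> \<Omega> \<sigma> \<longleftrightarrow>
    automorphism_action N \<sigma> \<and>
    (\<exists>E U. projection_valued_measure E \<and>
      is_spectral_integral E complex_of_real (modular_operator N \<pi> \<Omega>) \<and>
      (\<forall>t. U t \<in> bounded_ops \<and>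
        is_spectral_integral E (\<lambda>l. cis (t * ln l)) {(\<xi>, blinfun_apply (U t) \<xi>) | \<xi>. True}) \<and>
      (\<forall>t. \<forall>x\<in>N. \<pi> (\<sigma> t x) = U t o\<^sub>L \<pi> x o\<^sub>L U (- t)))"


section \<open>Dynamical systems and their joinings\<close>

text \<open>The tuple \<open>(N, \<rho>, \<alpha>)\<close> carries along a GNS representation of \<open>\<rho>\<close> and the modular
  automorphism group. These are no additional structure: the former exists and is unique up to
  unitary equivalence, and the latter is determined by \<open>(N, \<rho>)\<close>. The group is the type \<open>'g\<close>.\<close>

record (overloaded) ('h, 'k, 'g) wstar_system =
  alg :: "('h::chilbert_space) op set"
  state :: "'h op \<Rightarrow> complex"
  act :: "'g \<Rightarrow> 'h op \<Rightarrow> 'h op"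
  gns_rep :: "'h op \<Rightarrow> ('k::chilbert_space) op"
  gns_vec :: 'k
  modular :: "real \<Rightarrow> 'h op \<Rightarrow> 'h op"

text \<open>Strong continuity of the action is continuity of \<open>g \<mapsto> \<alpha>\<^sub>g(x)\<close> in the strong operator
  topology for every \<open>x\<close>.\<close>

definition wstar_dynamical_system ::
    "('h::chilbert_space, 'k::chilbert_space, 'g::{topological_group_add, t2_space}) wstar_system \<Rightarrow> bool" where
  "wstar_dynamical_system \<NN> \<longleftrightarrow>
    locally_compact_space (euclidean :: 'g topology) \<and>
    separable_space (euclidean :: 'g topology) \<and>
    von_neumann_algebra (alg \<NN>) \<and> separable_predual (alg \<NN>) \<and>
    faithful_normal_state (alg \<NN>) (state \<NN>) \<and>
    automorphism_action (alg \<NN>) (act \<NN>) \<and>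
    (\<forall>g. \<forall>x\<in>alg \<NN>. state \<NN> (act \<NN> g x) = state \<NN> x) \<and>
    (\<forall>x\<in>alg \<NN>. \<forall>\<xi>. continuous_on UNIV (\<lambda>g. blinfun_apply (act \<NN> g x) \<xi>)) \<and>
    gns_triple (alg \<NN>) (state \<NN>) (gns_rep \<NN>) (gns_vec \<NN>) \<and>
    modular_automorphism_group (alg \<NN>) (gns_rep \<NN>) (gns_vec \<NN>) (modular \<NN>)"

definition joinings ::
    "('h::chilbert_space, 'k::chilbert_space, 'g) wstar_system \<Rightarrow>
     ('h2::chilbert_space, 'k2::chilbert_space, 'g) wstar_system \<Rightarrow> ('h op \<Rightarrow> 'h2 op) set"
    ("J\<^sub>m") where
  "J\<^sub>m \<NN> \<MM> = {\<Phi>. normal_ucp (alg \<NN>) (alg \<MM>) \<Phi> \<and>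
    (\<forall>x\<in>alg \<NN>. state \<MM> (\<Phi> x) = state \<NN> x) \<and>
    (\<forall>t. \<forall>x\<in>alg \<NN>. modular \<MM> t (\<Phi> x) = \<Phi> (modular \<NN> t x)) \<and>
    (\<forall>g. \<forall>x\<in>alg \<NN>. act \<MM> g (\<Phi> x) = \<Phi> (act \<NN> g x))}"

text \<open>\<open>is_adjoint_map \<NN> \<MM> \<Phi> \<Psi>\<close>: the map \<open>\<Psi>\<close> is the adjoint \<open>\<Phi>\<^sup>*\<close> of
  \<open>\<Phi> \<in> J\<^sub>m \<NN> \<MM>\<close>. Faithfulness of the state determines \<open>\<Psi>\<close> uniquely on \<open>alg \<MM>\<close>.\<close>

definition is_adjoint_map ::
    "('h::chilbert_space, 'k::chilbert_space, 'g) wstar_system \<Rightarrow>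
     ('h2::chilbert_space, 'k2::chilbert_space, 'g) wstar_system \<Rightarrow>
     ('h op \<Rightarrow> 'h2 op) \<Rightarrow> ('h2 op \<Rightarrow> 'h op) \<Rightarrow> bool" where
  "is_adjoint_map \<NN> \<MM> \<Phi> \<Psi> \<longleftrightarrow>
    normal_ucp (alg \<MM>) (alg \<NN>) \<Psi> \<and>
    (\<forall>x\<in>alg \<NN>. \<forall>y\<in>alg \<MM>. state \<NN> (\<Psi> y o\<^sub>L x) = state \<MM> (y o\<^sub>L \<Phi> x))"

definition subsystem_embedding ::
    "('h::chilbert_space, 'k::chilbert_space, 'g) wstar_system \<Rightarrow>
     ('h2::chilbert_space, 'k2::chilbert_space, 'g) wstar_system \<Rightarrow> ('h op \<Rightarrow> 'h2 op) \<Rightarrow> bool" where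
  "subsystem_embedding \<BB> \<NN> \<iota> \<longleftrightarrow>
    \<iota> \<in> J\<^sub>m \<BB> \<NN> \<and> star_hom (alg \<BB>) (alg \<NN>) \<iota> \<and> inj_on \<iota> (alg \<BB>)"

definition common_subsystem ::
    "('b::chilbert_space, 'c::chilbert_space, 'g::{topological_group_add, t2_space}) wstar_system \<Rightarrow>
     ('b op \<Rightarrow> 'h op) \<Rightarrow> ('b op \<Rightarrow> 'h2 op) \<Rightarrow>
     ('h::chilbert_space, 'k::chilbert_space, 'g) wstar_system \<Rightarrow>
     ('h2::chilbert_space, 'k2::chilbert_space, 'g) wstar_system \<Rightarrow> bool" where
  "common_subsystem \<BB> \<iota>\<^sub>N \<iota>\<^sub>M \<NN> \<MM> \<longleftrightarrow>
    wstar_dynamical_system \<BB> \<and> subsystem_embedding \<BB> \<NN> \<iota>\<^sub>N \<and> subsystem_embedding \<BB> \<MM> \<iota>\<^sub>M"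

definition joinings_over ::
    "('b::chilbert_space, 'c::chilbert_space, 'g) wstar_system \<Rightarrow>
     ('b op \<Rightarrow> 'h op) \<Rightarrow> ('b op \<Rightarrow> 'h2 op) \<Rightarrow>
     ('h::chilbert_space, 'k::chilbert_space, 'g) wstar_system \<Rightarrow>
     ('h2::chilbert_space, 'k2::chilbert_space, 'g) wstar_system \<Rightarrow> ('h op \<Rightarrow> 'h2 op) set" where
  "joinings_over \<BB> \<iota>\<^sub>N \<iota>\<^sub>M \<NN> \<MM> = {\<Phi> \<in> J\<^sub>m \<NN> \<MM>.
    \<forall>y \<in> \<iota>\<^sub>N ` alg \<BB>. \<Phi> y = \<iota>\<^sub>M (inv_into (alg \<BB>) \<iota>\<^sub>N y)}"

end

theory Submission
  imports Defs
begin

text \<open>On the level of \<open>L\<^sup>2\<close>, \<open>\<Phi>\<close> and \<open>\<Phi>\<^sup>*\<close> are adjoint contractions. If \<open>\<Phi>\<close> restricts to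
  \<open>\<iota>\<^sub>M \<circ> \<iota>\<^sub>N\<inverse>\<close> on \<open>\<iota>\<^sub>N(B)\<close>, it maps \<open>n = \<iota>\<^sub>N(b)\<close> to the vector \<open>m = \<iota>\<^sub>M(b)\<close> of the same length, and
  therefore \<open>\<parallel>\<Phi>\<^sup>*(m) - n\<parallel>\<^sup>2 \<le> \<parallel>m\<parallel>\<^sup>2 - 2 Re \<langle>m, \<Phi>(n)\<rangle> + \<parallel>n\<parallel>\<^sup>2 = 0\<close>, so that no multiplicative domains
  are needed. The converse is the same statement for \<open>\<Phi>\<^sup>*\<close>, whose adjoint is \<open>\<Phi>\<close>. That
  \<open>\<Phi>\<^sup>*\<close> commutes with the modular groups relies on their preserving the states: from
  \<open>\<Delta> \<Omega> = \<Omega>\<close> the cyclic vector lies in the spectral subspace of \<open>\<Delta>\<close> at \<open>1\<close>, where \<open>\<Delta>\<^sup>i\<^sup>t\<close> is the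
  identity.\<close>

section \<open>Inner products and adjoints\<close>

lemma scaleC_minus1: "(- 1) *\<^sub>C x = - (x :: 'a::chilbert_space)"
  using scaleC_of_real[of "- 1" x] by simp

lemma scaleC_zero_right: "c *\<^sub>C 0 = (0 :: 'a::chilbert_space)"
  using scaleC_add_right[of c 0 "0 :: 'a"] by simp

lemma cinner_add_left: "cinner (x + y) z = cinner x z + cinner y (z :: 'a::chilbert_space)"
  by (metis cinner_add_right cinner_commute complex_cnj_add)

lemma cinner_minus_right: "cinner x (- y) = - cinner x (y :: 'a::chilbert_space)"
  using cinner_scaleC_right[of x "- 1" y] by (simp add: scaleC_minus1)

lemma cinner_minus_left: "cinner (- x) y = - cinner x (y :: 'a::chilbert_space)"
  by (metis cinner_minus_right cinner_commute complex_cnj_minus)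

lemma cinner_diff_right: "cinner x (y - z) = cinner x y - cinner x (z :: 'a::chilbert_space)"
  using cinner_add_right[of x y "- z"] by (simp add: cinner_minus_right)

lemma cinner_diff_left: "cinner (x - y) z = cinner x z - cinner y (z :: 'a::chilbert_space)"
  using cinner_add_left[of x "- y" z] by (simp add: cinner_minus_left)

lemma cinner_zero_right [simp]: "cinner x (0 :: 'a::chilbert_space) = 0"
  using cinner_add_right[of x 0 0] by simp

lemma cinner_zero_left [simp]: "cinner (0 :: 'a::chilbert_space) x = 0"
  using cinner_add_left[of 0 0 x] by simp

lemma cinner_scaleR_right: "cinner x (r *\<^sub>R y) = r * cinner x (y :: 'a::chilbert_space)"
  by (metis cinner_scaleC_right scaleC_of_real)

lemma cinner_scaleR_left: "cinner (r *\<^sub>R x) y = r * cinner x (y :: 'a::chilbert_space)"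
  by (metis cinner_scaleC_left scaleC_of_real complex_cnj_complex_of_real)

lemmas cinner_simps = cinner_add_left cinner_add_right cinner_diff_left cinner_diff_right
  cinner_minus_left cinner_minus_right cinner_scaleC_left cinner_scaleC_right

lemma cinner_self: "cinner x x = complex_of_real ((norm (x :: 'a::chilbert_space))\<^sup>2)"
proof (rule complex_eqI)
  have "0 \<le> Re (cinner x x)"
    using norm_eq_sqrt_cinner[of x] norm_ge_zero[of x] by simp
  then show "Re (cinner x x) = Re (complex_of_real ((norm x)\<^sup>2))"
    by (simp add: norm_eq_sqrt_cinner)
  show "Im (cinner x x) = Im (complex_of_real ((norm x)\<^sup>2))"
    using arg_cong[OF cinner_commute[of x x], of Im] by simp
qed

lemma cinner_eq_rightI:
  assumes "\<And>\<eta>. cinner \<eta> x = cinner \<eta> (y :: 'a::chilbert_space)"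
  shows "x = y"
proof -
  have "cinner (x - y) (x - y) = 0"
    using assms[of "x - y"] by (simp add: cinner_diff_right)
  then show ?thesis by (simp add: cinner_self)
qed

text \<open>The values \<open>c = 1\<close> and \<open>c = \<i>\<close> separate the linear from the
  antilinear coefficient. This turns identities between quadratic forms into statements about
  off-diagonal matrix coefficients.\<close>

lemma polarization_eq_0:
  assumes "\<And>c. c * u + cnj c * v = 0"
  shows "u = 0" and "v = 0"
proof -
  have "u + v = 0" "\<i> * (u - v) = 0"
    using assms[of 1] assms[of \<i>] by (simp_all add: algebra_simps)
  then show "u = 0" "v = 0" by (auto simp: complex_eq_iff)
qed

lemma bounded_ops_apply:
  assumes "T \<in> bounded_ops"
  shows "blinfun_apply T (c *\<^sub>C \<xi>) = c *\<^sub>C blinfun_apply T \<xi>"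
  using assms by (simp add: bounded_ops_def)

lemma is_adj_id: "is_adj id_blinfun id_blinfun"
  by (simp add: is_adj_def)

lemma is_adj_sym:
  assumes "is_adj T T'"
  shows "is_adj T' T"
  using assms unfolding is_adj_def by (metis cinner_commute)

lemma is_adj_right:
  assumes "is_adj T T'"
  shows "cinner \<xi> (blinfun_apply T' \<eta>) = cinner (blinfun_apply T \<xi>) \<eta>"
  using is_adj_sym[OF assms] by (simp add: is_adj_def)

lemma adj_eq:
  assumes "is_adj T T'"
  shows "adj T = T'"
  unfolding adj_def
proof (rule the_equality, rule assms)
  fix S assume "is_adj T S"
  then show "S = T'"
    using assms by (metis blinfun_eqI cinner_eq_rightI is_adj_right)
qed

lemma is_adj_compose:
  assumes "is_adj S S'" "is_adj T T'"
  shows "is_adj (S o\<^sub>L T) (T' o\<^sub>L S')"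
  using assms by (simp add: is_adj_def)

lemma is_adj_diff:
  assumes "is_adj S S'" "is_adj T T'"
  shows "is_adj (S - T) (S' - T')"
  using assms by (simp add: is_adj_def blinfun.diff_left cinner_simps)

lemma positive_op_selfadjoint:
  fixes T :: "('h::chilbert_space) op"
  assumes "T \<in> bounded_ops"
    and real: "\<And>\<xi>. cinner \<xi> (blinfun_apply T \<xi>) \<in> \<real>"
  shows "is_adj T T"
proof -
  have Im0: "Im (cinner \<xi> (blinfun_apply T \<xi>)) = 0" for \<xi>
    using real[of \<xi>] by (simp add: complex_is_Real_iff)
  have "cinner (blinfun_apply T \<xi>) \<eta> = cinner \<xi> (blinfun_apply T \<eta>)" for \<xi> \<eta>
  proof -
    let ?u = "cinner \<xi> (blinfun_apply T \<eta>)" and ?v = "cinner \<eta> (blinfun_apply T \<xi>)"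
    \<comment> \<open>These are the cross terms of the form at
      \<open>\<xi> + c *\<^sub>C \<eta>\<close>, whose diagonal terms are real. The value
      \<open>c = 1\<close> compares the imaginary parts of \<open>?u\<close> and \<open>?v\<close>,
      and \<open>c = \<i>\<close> the real parts.\<close>
    have "Im (c * ?u + cnj c * ?v) = 0" for c
      using Im0[of "\<xi> + c *\<^sub>C \<eta>"] Im0[of \<xi>] Im0[of "c *\<^sub>C \<eta>"]
      by (simp add: blinfun.add_right bounded_ops_apply[OF assms(1)] cinner_simps algebra_simps)
    from this[of 1] this[of \<i>] have "cnj ?v = ?u"
      by (simp add: complex_eq_iff)
    then show ?thesis by (metis cinner_commute)
  qed
  then show ?thesis by (simp add: is_adj_def)
qed

text \<open>The form is nonnegative at \<open>x + s *\<^sub>C y\<close>. Taking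
  \<open>s = t * cnj a\<close> makes the cross terms real and leaves a real quadratic polynomial in
  \<open>t\<close>, whose nonnegativity yields the bound.\<close>

lemma positive_op_Cauchy_Schwarz:
  fixes T :: "('h::chilbert_space) op"
  assumes T: "T \<in> bounded_ops" "is_adj T T"
    and pos: "\<And>\<xi>. 0 \<le> Re (cinner \<xi> (blinfun_apply T \<xi>))"
  shows "(cmod (cinner x (blinfun_apply T y)))\<^sup>2
    \<le> Re (cinner x (blinfun_apply T x)) * Re (cinner y (blinfun_apply T y))"
proof -
  define a p q where "a = cinner x (blinfun_apply T y)"
    and "p = Re (cinner x (blinfun_apply T x))" and "q = Re (cinner y (blinfun_apply T y))"
  have yx: "cinner y (blinfun_apply T x) = cnj a"
    unfolding a_def using T(2) by (metis cinner_commute is_adj_def)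
  have quad: "0 \<le> p + 2 * t * (cmod a)\<^sup>2 + t\<^sup>2 * (cmod a)\<^sup>2 * q" for t :: real
  proof -
    define s where "s = complex_of_real t * cnj a"
    have sa: "s * a = complex_of_real (t * (cmod a)\<^sup>2)"
    proof -
      have "s * a = complex_of_real t * (a * cnj a)" by (simp add: s_def)
      then show ?thesis by (simp only: complex_norm_square[symmetric] of_real_mult)
    qed
    then have sa': "cnj s * cnj a = complex_of_real (t * (cmod a)\<^sup>2)"
      by (metis complex_cnj_mult complex_cnj_complex_of_real)
    have ss: "cnj s * s = complex_of_real (t\<^sup>2 * (cmod a)\<^sup>2)"
    proof -
      have "cnj s * s = complex_of_real (t\<^sup>2) * (a * cnj a)"
        by (simp add: s_def power2_eq_square)
      then show ?thesis by (simp only: complex_norm_square[symmetric] of_real_mult)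
    qed
    have "cinner (x + s *\<^sub>C y) (blinfun_apply T (x + s *\<^sub>C y)) =
        cinner x (blinfun_apply T x) + s * a + cnj s * cnj a
        + (cnj s * s) * cinner y (blinfun_apply T y)"
      by (simp add: blinfun.add_right bounded_ops_apply[OF T(1)] cinner_simps yx a_def[symmetric]
          algebra_simps)
    then show ?thesis
      using pos[of "x + s *\<^sub>C y"] unfolding sa sa' ss by (simp add: p_def q_def)
  qed
  have "(cmod a)\<^sup>2 \<le> p * q"
  proof (cases "q = 0")
    case True
    have "a = 0"
    proof (rule ccontr)
      assume "a \<noteq> 0"
      \<comment> \<open>For \<open>q = 0\<close> the polynomial is affine in \<open>t\<close>, and
        this \<open>t\<close> gives it the value -1.\<close>
      then show False using quad[of "- (p + 1) / (2 * (cmod a)\<^sup>2)"] True by (simp add: field_simps)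
    qed
    then show ?thesis using True by simp
  next
    case False
    then have "q > 0" using pos[of y] by (simp add: q_def)
    \<comment> \<open>The parabola is minimal at \<open>t = - 1 / q\<close>, with value
      \<open>p - (cmod a)\<^sup>2 / q\<close>.\<close>
    then show ?thesis
      using quad[of "- 1 / q"] by (simp add: field_simps power2_eq_square)
  qed
  then show ?thesis by (simp add: a_def p_def q_def)
qed

lemma Cauchy_Schwarz_cinner: "cmod (cinner x y) \<le> norm x * norm (y :: 'h::chilbert_space)"
proof -
  have "(id_blinfun :: 'h op) \<in> bounded_ops" by (simp add: bounded_ops_def)
  from positive_op_Cauchy_Schwarz[OF this is_adj_id, of x y]
  have "(cmod (cinner x y))\<^sup>2 \<le> (norm x * norm y)\<^sup>2"
    by (simp add: cinner_self power_mult_distrib)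
  then show ?thesis by (rule power2_le_imp_le) simp
qed

lemma bounded_bilinear_cinner: "bounded_bilinear (cinner :: 'h::chilbert_space \<Rightarrow> 'h \<Rightarrow> complex)"
proof (rule bounded_bilinear.intro)
  show "\<exists>K. \<forall>a b :: 'h. norm (cinner a b) \<le> norm a * norm b * K"
    using Cauchy_Schwarz_cinner by (intro exI[of _ 1]) auto
qed (simp_all add: cinner_simps cinner_scaleR_left cinner_scaleR_right scaleR_conv_of_real)

text \<open>Cauchy-Schwarz for the form of \<open>T\<close>, taken between \<open>T \<xi>\<close>
  and \<open>\<xi>\<close>, bounds the fourth power of the norm of \<open>T \<xi>\<close> by the
  product of the squared norms of \<open>T \<xi>\<close> and \<open>\<xi>\<close>.\<close>

lemma norm_positive_contraction:
  fixes T :: "('h::chilbert_space) op"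
  assumes T: "T \<in> bounded_ops" "is_adj T T"
    and pos: "\<And>\<xi>. 0 \<le> Re (cinner \<xi> (blinfun_apply T \<xi>))"
    and le: "\<And>\<xi>. Re (cinner \<xi> (blinfun_apply T \<xi>)) \<le> (norm \<xi>)\<^sup>2"
  shows "norm T \<le> 1"
proof (rule norm_blinfun_bound)
  fix \<xi> :: 'h
  let ?n = "norm (blinfun_apply T \<xi>)"
  have "(?n\<^sup>2)\<^sup>2 = (cmod (cinner (blinfun_apply T \<xi>) (blinfun_apply T \<xi>)))\<^sup>2"
    by (simp add: cinner_self norm_power)
  also have "\<dots> \<le> ?n\<^sup>2 * (norm \<xi>)\<^sup>2"
    using positive_op_Cauchy_Schwarz[OF T pos] mult_mono[OF le le _ pos]
    by (meson order_trans zero_le_power2)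
  finally have sq: "?n\<^sup>2 * ?n\<^sup>2 \<le> ?n\<^sup>2 * (norm \<xi>)\<^sup>2"
    by (simp only: power2_eq_square[of "?n\<^sup>2"])
  have "?n\<^sup>2 \<le> (norm \<xi>)\<^sup>2"
  proof (cases "?n = 0")
    case False
    then have "0 < ?n\<^sup>2" by simp
    with sq show ?thesis by (rule mult_left_le_imp_le)
  qed simp
  then show "?n \<le> 1 * norm \<xi>"
    unfolding mult_1 by (rule power2_le_imp_le) simp
qed simp


section \<open>Von Neumann algebras and unital completely positive maps\<close>

lemma scaleC_op_apply [simp]: "blinfun_apply (scaleC_op c T) \<xi> = c *\<^sub>C blinfun_apply T \<xi>"
  by (simp add: scaleC_op.rep_eq)

lemma scaleC_op_minus1: "scaleC_op (- 1) T = - T"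
  by (rule blinfun_eqI) (simp add: scaleC_minus1 blinfun.minus_left)

section \<open>Commutants and the algebraic structure of von Neumann algebras\<close>

lemma commutant_iff:
  "T \<in> commutant X \<longleftrightarrow> T \<in> bounded_ops \<and>
    (\<forall>x\<in>X. \<forall>\<xi>. blinfun_apply T (blinfun_apply x \<xi>) = blinfun_apply x (blinfun_apply T \<xi>))"
proof -
  have "T o\<^sub>L x = x o\<^sub>L T \<longleftrightarrow>
      (\<forall>\<xi>. blinfun_apply T (blinfun_apply x \<xi>) = blinfun_apply x (blinfun_apply T \<xi>))" for x
    by (metis blinfun_apply_blinfun_compose blinfun_eqI)
  then show ?thesis by (simp add: commutant_def)
qed

lemma commutant_id: "id_blinfun \<in> commutant S"
  by (simp add: commutant_iff bounded_ops_def)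

lemma commutant_add:
  assumes "S \<in> commutant X" "T \<in> commutant X"
  shows "S + T \<in> commutant X"
  using assms by (simp add: commutant_iff bounded_ops_def blinfun.add_left blinfun.add_right
      scaleC_add_right)

text \<open>Operators are a priori only real-linear, so the elements of \<open>X\<close> have to be
  complex-linear in order to commute with scalars.\<close>

lemma commutant_scaleC:
  assumes "X \<subseteq> bounded_ops" "T \<in> commutant X"
  shows "scaleC_op c T \<in> commutant X"
proof -
  have "blinfun_apply x (c *\<^sub>C \<xi>) = c *\<^sub>C blinfun_apply x \<xi>" if "x \<in> X" for x \<xi>
    using assms(1) that bounded_ops_apply by blast
  then show ?thesis
    using assms(2) by (simp add: commutant_iff bounded_ops_def scaleC_scaleC mult.commute)
qed

lemma commutant_compose:
  assumes "S \<in> commutant X" "T \<in> commutant X"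
  shows "S o\<^sub>L T \<in> commutant X"
  using assms unfolding commutant_iff bounded_ops_def by simp

context
  fixes N :: "('h::chilbert_space) op set"
  assumes N: "von_neumann_algebra N"
begin

lemma vn_bounded_ops: "x \<in> N \<Longrightarrow> x \<in> bounded_ops"
  using N by (auto simp: von_neumann_algebra_def)

lemma vn_bicommutant: "commutant (commutant N) = N"
  using N by (auto simp: von_neumann_algebra_def)

text \<open>A von Neumann algebra equals its bicommutant, so the unit and the algebraic closure
  properties are inherited from commutants in general.\<close>

lemma vn_id: "id_blinfun \<in> N"
  using commutant_id[of "commutant N"] by (simp add: vn_bicommutant)

lemma vn_add: "x \<in> N \<Longrightarrow> y \<in> N \<Longrightarrow> x + y \<in> N"
  using commutant_add[of x "commutant N" y] by (simp add: vn_bicommutant)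

lemma vn_scaleC: "x \<in> N \<Longrightarrow> scaleC_op c x \<in> N"
  using commutant_scaleC[of "commutant N" x c] unfolding vn_bicommutant
  by (auto simp: commutant_def)

lemma vn_compose: "x \<in> N \<Longrightarrow> y \<in> N \<Longrightarrow> x o\<^sub>L y \<in> N"
  using commutant_compose[of x "commutant N" y] by (simp add: vn_bicommutant)

lemma vn_diff: "x \<in> N \<Longrightarrow> y \<in> N \<Longrightarrow> x - y \<in> N"
  using vn_add[of x "scaleC_op (- 1) y"] vn_scaleC[of y "- 1"] by (simp add: scaleC_op_minus1)

lemma vn_is_adj: "x \<in> N \<Longrightarrow> is_adj x (adj x)"
  and vn_adj: "x \<in> N \<Longrightarrow> adj x \<in> N"
  using N by (auto simp: von_neumann_algebra_def dest!: bspec[of N _ x] dest: adj_eq)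

lemma vn_adj_adj: "x \<in> N \<Longrightarrow> adj (adj x) = x"
  by (rule adj_eq[OF is_adj_sym[OF vn_is_adj]])

lemma linear_functional_on_diff:
  assumes "linear_functional_on N \<omega>" "x \<in> N" "y \<in> N"
  shows "\<omega> (x - y) = \<omega> x - \<omega> y"
proof -
  have "\<omega> (x + scaleC_op (- 1) y) = \<omega> x + - 1 * \<omega> y"
    using assms vn_scaleC[of y "- 1"] unfolding linear_functional_on_def by metis
  then show ?thesis by (simp add: scaleC_op_minus1)
qed

text \<open>Positivity on 2 x 2 matrices is applied to a matrix whose form is the squared norm of
  \<open>\<zeta> 0 + x (\<zeta> 1)\<close>. Both preservation of adjoints and the Kadison-Schwarz
  inequality are read off from its image.\<close>

lemma ucp_gram_nonneg:
  assumes lin: "linear_map_on N M \<Phi>" and unit: "\<Phi> id_blinfun = id_blinfun"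
    and cp: "completely_positive N \<Phi>" and x: "x \<in> N"
  shows "cinner \<xi> \<xi> + cinner \<xi> (blinfun_apply (\<Phi> x) \<eta>) + cinner \<eta> (blinfun_apply (\<Phi> (adj x)) \<xi>)
    + cinner \<eta> (blinfun_apply (\<Phi> (adj x o\<^sub>L x)) \<eta>) \<in> \<real>\<^sub>\<ge>\<^sub>0"
proof -
  \<comment> \<open>the Gram matrix of \<open>(1, x)\<close>\<close>
  define X :: "nat \<Rightarrow> nat \<Rightarrow> 'h op" where
    "X i j = (if i = 0 then if j = 0 then id_blinfun else x
      else if j = 0 then adj x else adj x o\<^sub>L x)" for i j
  have "positive_matrix 2 X"
    unfolding positive_matrix_def
  proof
    fix \<zeta> :: "nat \<Rightarrow> 'h"
    let ?z = "\<zeta> 0 + blinfun_apply x (\<zeta> 1)"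
    have "(\<Sum>i<2. \<Sum>j<2. cinner (\<zeta> i) (blinfun_apply (X i j) (\<zeta> j))) = cinner ?z ?z"
      by (simp add: X_def numeral_2_eq_2 cinner_simps is_adj_right[OF vn_is_adj[OF x]])
    then show "(\<Sum>i<2. \<Sum>j<2. cinner (\<zeta> i) (blinfun_apply (X i j) (\<zeta> j))) \<in> \<real>\<^sub>\<ge>\<^sub>0"
      by (simp add: cinner_self)
  qed
  moreover have "X i j \<in> N" for i j
    using x by (simp add: X_def vn_id vn_adj vn_compose)
  ultimately have "positive_matrix 2 (\<lambda>i j. \<Phi> (X i j))"
    using cp by (simp add: completely_positive_def)
  from this[unfolded positive_matrix_def, rule_format, of "\<lambda>i. if i = 0 then \<xi> else \<eta>"]
  show ?thesis
    by (simp add: X_def numeral_2_eq_2 unit add_ac)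
qed

lemma ucp_is_adj:
  assumes lin: "linear_map_on N M \<Phi>" and unit: "\<Phi> id_blinfun = id_blinfun"
    and cp: "completely_positive N \<Phi>" and x: "x \<in> N"
    and M: "M \<subseteq> bounded_ops"
  shows "is_adj (\<Phi> x) (\<Phi> (adj x))"
proof -
  have "cinner (blinfun_apply (\<Phi> (adj x)) \<xi>) \<eta> = cinner \<xi> (blinfun_apply (\<Phi> x) \<eta>)" for \<xi> \<eta>
  proof -
    let ?u = "cinner \<xi> (blinfun_apply (\<Phi> x) \<eta>)"
      and ?v = "cinner \<eta> (blinfun_apply (\<Phi> (adj x)) \<xi>)"
    have bd: "\<Phi> (adj x) \<in> bounded_ops"
      using lin M vn_adj[OF x] by (auto simp: linear_map_on_def)
    note pos = ucp_gram_nonneg[OF lin unit cp x, unfolded complex_nonneg_Reals_iff]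
    \<comment> \<open>Inserting \<open>c *\<^sub>C \<xi>\<close> rotates the cross terms. The zero
      vector in place of \<open>\<xi>\<close> shows that the last diagonal term is real, so only the
      cross terms contribute to the imaginary part.\<close>
    have "Im (cnj c * ?u + c * ?v) = 0" for c
      using pos[of "c *\<^sub>C \<xi>" \<eta>] pos[of 0 \<eta>]
      by (simp add: bounded_ops_apply[OF bd] cinner_simps blinfun.zero_right cinner_self)
    from this[of 1] this[of \<i>] have "cnj ?v = ?u"
      by (simp add: complex_eq_iff)
    then show ?thesis by (metis cinner_commute)
  qed
  then show ?thesis by (simp add: is_adj_def)
qed

text \<open>The choice \<open>\<xi> = - \<Phi> x \<eta>\<close> completes the square: the first two
  terms of the Gram form cancel, and the other two are the form of the difference.\<close>

lemma Kadison_Schwarz: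
  assumes lin: "linear_map_on N M \<Phi>" and unit: "\<Phi> id_blinfun = id_blinfun"
    and cp: "completely_positive N \<Phi>" and x: "x \<in> N"
    and M: "M \<subseteq> bounded_ops"
  shows "cinner \<eta> (blinfun_apply (\<Phi> (adj x o\<^sub>L x) - (\<Phi> (adj x) o\<^sub>L \<Phi> x)) \<eta>) \<in> \<real>\<^sub>\<ge>\<^sub>0"
  using ucp_gram_nonneg[OF lin unit cp x, of "- blinfun_apply (\<Phi> x) \<eta>" \<eta>]
  by (simp add: cinner_simps blinfun.diff_left blinfun.minus_right
      is_adj_right[OF ucp_is_adj[OF assms]])

end


section \<open>Normal states\<close>

text \<open>The products of the norms are summable by
  \<open>a * b \<le> a\<^sup>2 + b\<^sup>2\<close>. Boundedness of these functionals is what makes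
  the norm topology finer than the ultraweak one.\<close>

lemma vector_functional_bounded_linear:
  assumes "summable (\<lambda>n. (norm (\<xi> n))\<^sup>2)" "summable (\<lambda>n. (norm (\<eta> n))\<^sup>2)"
  shows "bounded_linear (vector_functional \<xi> \<eta> :: ('h::chilbert_space) op \<Rightarrow> complex)"
proof -
  let ?s = "\<lambda>n. norm (\<xi> n) * norm (\<eta> n)"
  have s: "summable ?s"
  proof (rule summable_comparison_test')
    show "summable (\<lambda>n. (norm (\<xi> n))\<^sup>2 + (norm (\<eta> n))\<^sup>2)"
      using assms by (rule summable_add)
    show "norm (?s n) \<le> (norm (\<xi> n))\<^sup>2 + (norm (\<eta> n))\<^sup>2" if "n \<ge> 0" for n
    proof -
      have "2 * norm (\<xi> n) * norm (\<eta> n) \<le> (norm (\<xi> n))\<^sup>2 + (norm (\<eta> n))\<^sup>2"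
        by (rule sum_squares_bound)
      moreover have "0 \<le> norm (\<xi> n) * norm (\<eta> n)" by simp
      ultimately show ?thesis by (simp add: abs_mult del: mult_nonneg_nonneg)
    qed
  qed
  have le: "norm (cinner (\<xi> n) (blinfun_apply x (\<eta> n))) \<le> ?s n * norm x" for n and x :: "'h op"
  proof -
    have "norm (cinner (\<xi> n) (blinfun_apply x (\<eta> n))) \<le> norm (\<xi> n) * (norm x * norm (\<eta> n))"
      using Cauchy_Schwarz_cinner norm_blinfun by (meson order_trans mult_left_mono norm_ge_zero)
    then show ?thesis by (simp add: mult_ac)
  qed
  have sn: "summable (\<lambda>n. norm (cinner (\<xi> n) (blinfun_apply x (\<eta> n))))" for x :: "'h op"
    by (rule summable_comparison_test'[OF summable_mult2[OF s, of "norm x"]]) (simp add: le)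
  note sc = summable_norm_cancel[OF sn]
  show ?thesis
  proof (rule bounded_linear_intro)
    fix x y :: "'h op" and r :: real
    show "vector_functional \<xi> \<eta> (x + y) = vector_functional \<xi> \<eta> x + vector_functional \<xi> \<eta> y"
      by (simp add: vector_functional_def blinfun.add_left cinner_simps suminf_add[OF sc sc])
    show "vector_functional \<xi> \<eta> (r *\<^sub>R x) = r *\<^sub>R vector_functional \<xi> \<eta> x"
      by (simp add: vector_functional_def blinfun.scaleR_left cinner_scaleR_right suminf_mult[OF sc]
          scaleR_conv_of_real)
    have "norm (vector_functional \<xi> \<eta> x) \<le> (\<Sum>n. norm (cinner (\<xi> n) (blinfun_apply x (\<eta> n))))"
      unfolding vector_functional_def by (rule summable_norm[OF sn])
    also have "\<dots> \<le> (\<Sum>n. ?s n * norm x)"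
      by (rule suminf_le[OF le sn summable_mult2[OF s]])
    also have "\<dots> = suminf ?s * norm x"
      by (rule suminf_mult2[OF s, symmetric])
    finally show "norm (vector_functional \<xi> \<eta> x) \<le> norm x * suminf ?s"
      by (simp only: mult.commute[of "norm x" "suminf ?s"])
  qed
qed

text \<open>On \<open>N\<close> the norm topology is finer than the ultraweak one, so
  \<open>\<omega>\<close> is norm-continuous, and for a linear functional continuity at
  \<open>0\<close> gives a bound.\<close>

lemma predual_bounded:
  assumes N: "von_neumann_algebra N" and \<omega>: "\<omega> \<in> predual N"
  obtains K where "\<And>x. x \<in> N \<Longrightarrow> cmod (\<omega> x) \<le> K * norm x"
proof -
  have lin: "linear_functional_on N \<omega>" and ct: "continuous_map (ultraweak N) euclidean \<omega>"
    using \<omega> by (auto simp: predual_def)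
  have "continuous_map (top_of_set N) (ultraweak N) id"
    unfolding ultraweak_def
  proof (rule continuous_map_pullback')
    show "continuous_map (top_of_set N) (product_topology (\<lambda>_. euclidean) vector_functionals)
        ((\<lambda>x. restrict (\<lambda>\<omega>. \<omega> x) vector_functionals) \<circ> id)"
      by (auto simp: continuous_map_componentwise vector_functionals_def
          intro!: linear_continuous_on vector_functional_bounded_linear)
  qed auto
  from continuous_map_compose[OF this ct] have "continuous_on N \<omega>"
    by simp
  moreover have "0 \<in> N"
    using vn_diff[OF N vn_id[OF N] vn_id[OF N]] by simp
  ultimately obtain d where d: "d > 0" "\<And>x. x \<in> N \<Longrightarrow> dist x 0 < d \<Longrightarrow> dist (\<omega> x) (\<omega> 0) < 1"
    unfolding continuous_on_iff by (meson zero_less_one)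
  have \<omega>0: "\<omega> 0 = 0"
    using linear_functional_on_diff[OF N lin vn_id[OF N] vn_id[OF N]] by simp
  have "cmod (\<omega> x) \<le> (2 / d) * norm x" if x: "x \<in> N" for x
  proof (cases "x = 0")
    case False
    \<comment> \<open>The factor \<open>r\<close> rescales \<open>x\<close> to norm
      \<open>d / 2\<close>, inside the ball where \<open>\<omega>\<close> stays below 1. It has to
      enter as a complex scalar, the only kind in \<open>linear_functional_on\<close>.\<close>
    define r where "r = d / (2 * norm x)"
    have r: "r > 0" using d(1) False by (simp add: r_def)
    have eq: "scaleC_op (complex_of_real r) x = r *\<^sub>R x"
      by (rule blinfun_eqI) (simp add: scaleC_of_real blinfun.scaleR_left)
    have mem: "r *\<^sub>R x \<in> N"
      using vn_scaleC[OF N x, of "complex_of_real r"] by (simp add: eq)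
    have "\<omega> (r *\<^sub>R x) = r * \<omega> x"
      using lin x unfolding linear_functional_on_def eq[symmetric] by blast
    moreover have "norm (r *\<^sub>R x) < d"
      using d(1) False by (simp add: r_def)
    ultimately have "r * cmod (\<omega> x) < 1"
      using d(2)[OF mem] r by (simp add: \<omega>0 norm_mult)
    then show ?thesis
      using d(1) False by (simp add: r_def field_simps)
  qed (simp add: \<omega>0)
  then show thesis by (rule that)
qed

text \<open>If \<open>r 0 > 1\<close>, then \<open>r k \<ge> r 0 ^ (2 ^ k)\<close> for all
  \<open>k\<close>, which is unbounded.\<close>

lemma repeated_squaring_le_1:
  fixes r :: "nat \<Rightarrow> real"
  assumes nonneg: "\<And>k. 0 \<le> r k" and sq: "\<And>k. (r k)\<^sup>2 \<le> r (Suc k)" and bd: "\<And>k. r k \<le> K"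
  shows "r 0 \<le> 1"
proof (rule ccontr)
  assume "\<not> r 0 \<le> 1"
  then have r0: "1 < r 0" by simp
  have pow: "r 0 ^ (2 ^ k) \<le> r k" for k
  proof (induction k)
    case (Suc k)
    have "r 0 ^ (2 ^ Suc k) = (r 0 ^ (2 ^ k))\<^sup>2"
      by (simp add: power_mult[symmetric] mult.commute)
    also have "\<dots> \<le> (r k)\<^sup>2"
      using Suc nonneg[of 0] by (intro power_mono) auto
    finally show ?case using sq[of k] by linarith
  qed simp
  obtain n where "K < r 0 ^ n"
    using real_arch_pow[OF r0] by blast
  also have "\<dots> \<le> r 0 ^ (2 ^ n)"
    using r0 by (intro power_increasing) (auto intro: less_imp_le less_exp)
  also have "\<dots> \<le> K"
    using pow bd by (meson order_trans)
  finally show False by simp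
qed

section \<open>States with a GNS representation: positivity and separation\<close>

locale normal_state =
  fixes N :: "('h::chilbert_space) op set" and \<rho> :: "'h op \<Rightarrow> complex"
    and \<pi> :: "'h op \<Rightarrow> ('k::chilbert_space) op" and \<Omega> :: 'k
  assumes vn: "von_neumann_algebra N"
    and state: "faithful_normal_state N \<rho>"
    and gns: "gns_triple N \<rho> \<pi> \<Omega>"
begin

lemma linear: "linear_functional_on N \<rho>"
  using state by (simp add: faithful_normal_state_def predual_def)

lemma state_scaleC: "x \<in> N \<Longrightarrow> \<rho> (scaleC_op c x) = c * \<rho> x"
  using linear by (auto simp: linear_functional_on_def)

lemmas state_diff = linear_functional_on_diff[OF vn linear]

lemma state_id: "\<rho> id_blinfun = 1"
  using state by (simp add: faithful_normal_state_def)

lemma state_gns: "x \<in> N \<Longrightarrow> \<rho> x = cinner \<Omega> (blinfun_apply (\<pi> x) \<Omega>)"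
  and gns_hom: "star_hom N bounded_ops \<pi>"
  and gns_dense: "closure ((\<lambda>x. blinfun_apply (\<pi> x) \<Omega>) ` N) = UNIV"
  using gns by (auto simp: gns_triple_def)

lemma gns_compose: "x \<in> N \<Longrightarrow> y \<in> N \<Longrightarrow> \<pi> (x o\<^sub>L y) = \<pi> x o\<^sub>L \<pi> y"
  and gns_is_adj: "x \<in> N \<Longrightarrow> is_adj (\<pi> x) (\<pi> (adj x))"
  using gns_hom by (auto simp: star_hom_def)

text \<open>Unitality is not built into \<open>star_hom\<close>. The operator
  \<open>\<pi> id_blinfun\<close> fixes the dense set of vectors \<open>\<pi> x \<Omega>\<close>,
  and its fixed-point set is closed.\<close>

lemma gns_id: "\<pi> id_blinfun = id_blinfun"
proof (rule blinfun_eqI)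
  fix \<zeta>
  have "closed {\<zeta>. blinfun_apply (\<pi> id_blinfun) \<zeta> = \<zeta>}"
    by (intro closed_Collect_eq continuous_intros)
  moreover have "blinfun_apply (\<pi> id_blinfun) (blinfun_apply (\<pi> x) \<Omega>) = blinfun_apply (\<pi> x) \<Omega>"
    if "x \<in> N" for x
  proof -
    have "id_blinfun o\<^sub>L x = x" by (rule blinfun_eqI) simp
    then show ?thesis
      using gns_compose[OF vn_id[OF vn] that] by (metis blinfun_apply_blinfun_compose)
  qed
  ultimately have "closure ((\<lambda>x. blinfun_apply (\<pi> x) \<Omega>) ` N)
      \<subseteq> {\<zeta>. blinfun_apply (\<pi> id_blinfun) \<zeta> = \<zeta>}"
    by (intro closure_minimal) auto
  then show "blinfun_apply (\<pi> id_blinfun) \<zeta> = blinfun_apply id_blinfun \<zeta>"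
    by (auto simp: gns_dense)
qed

lemma norm_gns_vec: "norm \<Omega> = 1"
proof -
  have "complex_of_real ((norm \<Omega>)\<^sup>2) = 1"
    using state_gns[OF vn_id[OF vn]] by (simp only: state_id gns_id id_blinfun.rep_eq id_apply cinner_self)
  then have "(norm \<Omega>)\<^sup>2 = 1"
    using of_real_eq_1_iff by blast
  then show ?thesis using norm_ge_zero[of \<Omega>] by (simp add: power2_eq_1_iff)
qed

lemma state_adj:
  assumes "x \<in> N"
  shows "\<rho> (adj x) = cnj (\<rho> x)"
  using assms state_gns[OF assms] state_gns[OF vn_adj[OF vn assms]]
  by (metis cinner_commute gns_is_adj is_adj_right)

lemma state_adj_compose:
  assumes "x \<in> N"
  shows "\<rho> (adj x o\<^sub>L x) = complex_of_real ((norm (blinfun_apply (\<pi> x) \<Omega>))\<^sup>2)"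
  using assms
  by (simp add: state_gns[OF vn_compose[OF vn vn_adj[OF vn assms] assms]]
      gns_compose[OF vn_adj[OF vn assms] assms] is_adj_right[OF gns_is_adj] cinner_self del: of_real_power)

lemma state_Cauchy_Schwarz:
  assumes "x \<in> N"
  shows "(cmod (\<rho> x))\<^sup>2 \<le> cmod (\<rho> (adj x o\<^sub>L x))"
proof -
  have "cmod (\<rho> x) \<le> norm (blinfun_apply (\<pi> x) \<Omega>)"
    using Cauchy_Schwarz_cinner[of \<Omega> "blinfun_apply (\<pi> x) \<Omega>"]
    by (simp add: state_gns[OF assms] norm_gns_vec)
  then show ?thesis
    by (simp add: state_adj_compose[OF assms] norm_power power_mono)
qed

text \<open>A substitute for square roots in \<open>N\<close>: iterating the Cauchy--Schwarz inequality along
  \<open>h, h\<^sup>2, h\<^sup>4, \<dots>\<close> turns the mere boundedness of \<open>\<rho>\<close> into \<open>|\<rho> h| \<le> 1\<close>.\<close>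

lemma state_selfadjoint_contraction:
  assumes h: "h \<in> N" "is_adj h h" "norm h \<le> 1"
  shows "cmod (\<rho> h) \<le> 1"
proof -
  \<comment> \<open>Here \<open>f k\<close> is the power of \<open>h\<close> with exponent
    \<open>2 ^ k\<close>. It stays a self-adjoint contraction, so one bound for
    \<open>\<rho>\<close> serves all \<open>k\<close>.\<close>
  define f where "f k = ((\<lambda>h. h o\<^sub>L h) ^^ k) h" for k
  have f: "f k \<in> N \<and> is_adj (f k) (f k) \<and> norm (f k) \<le> 1" for k
  proof (induction k)
    case (Suc k)
    have "norm (f k o\<^sub>L f k) \<le> norm (f k) * norm (f k)"
      by (rule norm_blinfun_compose)
    also have "\<dots> \<le> 1"
      using Suc by (simp add: mult_le_one)
    finally have "norm (f k o\<^sub>L f k) \<le> 1" .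
    then show ?case
      using Suc by (simp add: f_def vn_compose[OF vn] is_adj_compose)
  qed (simp add: f_def h)
  have "\<rho> \<in> predual N"
    using state by (simp add: faithful_normal_state_def)
  then obtain K where K: "\<And>x. x \<in> N \<Longrightarrow> cmod (\<rho> x) \<le> K * norm x"
    using predual_bounded[OF vn] by blast
  have "cmod (\<rho> (f 0)) \<le> 1"
  proof (rule repeated_squaring_le_1[where r = "\<lambda>k. cmod (\<rho> (f k))" and K = "\<bar>K\<bar>"])
    fix k
    have "adj (f k) = f k" using f adj_eq by blast
    then show "(cmod (\<rho> (f k)))\<^sup>2 \<le> cmod (\<rho> (f (Suc k)))"
      using state_Cauchy_Schwarz[of "f k"] f by (simp add: f_def)
    have "cmod (\<rho> (f k)) \<le> K * norm (f k)" using K f by blast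
    also have "\<dots> \<le> \<bar>K\<bar> * norm (f k)" by (simp add: mult_right_mono)
    also have "\<dots> \<le> \<bar>K\<bar>" using f by (simp add: mult_left_le)
    finally show "cmod (\<rho> (f k)) \<le> \<bar>K\<bar>" .
  qed simp
  then show ?thesis by (simp add: f_def)
qed

text \<open>The definition of a state speaks of \<open>adj x o\<^sub>L x\<close>, and writing
  \<open>a\<close> in this form would take a square root. Instead \<open>a\<close> is normalised to
  \<open>b\<close> between 0 and 1. Then \<open>id_blinfun - b\<close> is a self-adjoint
  contraction, so its state is at most 1, the state of the unit.\<close>

lemma state_positive:
  assumes a: "a \<in> N" and pos: "\<And>\<xi>. cinner \<xi> (blinfun_apply a \<xi>) \<in> \<real>\<^sub>\<ge>\<^sub>0"
  shows "0 \<le> Re (\<rho> a)"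
proof (cases "a = 0")
  case True
  then show ?thesis using state_diff[OF a a] by simp
next
  case False
  define s where "s = norm a"
  have s: "s > 0" using False by (simp add: s_def)
  define b where "b = scaleC_op (complex_of_real (1 / s)) a"
  define h where "h = id_blinfun - b"
  have b: "b \<in> N" using a by (simp add: b_def vn_scaleC[OF vn])
  then have h: "h \<in> N" by (simp add: h_def vn_diff[OF vn] vn_id[OF vn])
  have b_form: "cinner \<xi> (blinfun_apply b \<xi>) = complex_of_real (1 / s) * cinner \<xi> (blinfun_apply a \<xi>)"
    for \<xi> by (simp add: b_def cinner_scaleC_right)
  have b_pos: "cinner \<xi> (blinfun_apply b \<xi>) \<in> \<real>" "0 \<le> Re (cinner \<xi> (blinfun_apply b \<xi>))" for \<xi>
    using pos[of \<xi>] s unfolding b_form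
    by (auto simp: complex_is_Real_iff complex_nonneg_Reals_iff)
  have b_le: "Re (cinner \<xi> (blinfun_apply b \<xi>)) \<le> (norm \<xi>)\<^sup>2" for \<xi>
  proof -
    have "Re (cinner \<xi> (blinfun_apply a \<xi>)) \<le> norm \<xi> * norm (blinfun_apply a \<xi>)"
      using complex_Re_le_cmod Cauchy_Schwarz_cinner by (meson order_trans)
    also have "\<dots> \<le> norm \<xi> * (s * norm \<xi>)"
      unfolding s_def by (intro mult_left_mono norm_blinfun norm_ge_zero)
    finally show ?thesis
      using s unfolding b_form by (simp add: field_simps power2_eq_square)
  qed
  have adj_h: "is_adj h h"
    unfolding h_def
    by (intro is_adj_diff is_adj_id positive_op_selfadjoint vn_bounded_ops[OF vn] b b_pos)
  have "norm h \<le> 1"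
    by (rule norm_positive_contraction[OF vn_bounded_ops[OF vn h] adj_h])
      (use b_pos b_le in \<open>simp_all add: h_def blinfun.diff_left cinner_simps cinner_self\<close>)
  then have "cmod (\<rho> h) \<le> 1"
    by (rule state_selfadjoint_contraction[OF h adj_h])
  then have "Re (\<rho> h) \<le> 1"
    using complex_Re_le_cmod order_trans by blast
  moreover have "\<rho> h = 1 - complex_of_real (1 / s) * \<rho> a"
    unfolding h_def b_def using a
    by (simp add: state_diff vn_id[OF vn] vn_scaleC[OF vn] state_id state_scaleC)
  ultimately have "0 \<le> Re (\<rho> a) / s" by simp
  then show ?thesis using s by (simp add: zero_le_divide_iff)
qed

lemma state_faithful:
  assumes a: "a \<in> N" and le: "Re (\<rho> (adj a o\<^sub>L a)) \<le> 0"
  shows "a = 0"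
proof -
  have "\<rho> (adj a o\<^sub>L a) \<in> \<real>\<^sub>\<ge>\<^sub>0"
    using state a by (simp add: faithful_normal_state_def)
  then have "\<rho> (adj a o\<^sub>L a) = 0"
    using le by (simp add: complex_nonneg_Reals_iff complex_eq_iff)
  then show ?thesis
    using state a by (simp add: faithful_normal_state_def)
qed

text \<open>With \<open>x = adj (a - b)\<close> the hypothesis says that the state vanishes on
  \<open>(a - b) o\<^sub>L adj (a - b)\<close>, and faithfulness applies to
  \<open>adj (a - b)\<close>.\<close>

lemma state_separating:
  assumes ab: "a \<in> N" "b \<in> N" and eq: "\<And>x. x \<in> N \<Longrightarrow> \<rho> (a o\<^sub>L x) = \<rho> (b o\<^sub>L x)"
  shows "a = b"
proof -
  let ?z = "adj (a - b)"
  have d: "a - b \<in> N" using ab by (rule vn_diff[OF vn])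
  then have z: "?z \<in> N" by (rule vn_adj[OF vn])
  have "(a - b) o\<^sub>L ?z = (a o\<^sub>L ?z) - (b o\<^sub>L ?z)"
    by (rule blinfun_eqI) (simp add: blinfun.diff_left)
  then have "\<rho> (adj ?z o\<^sub>L ?z) = 0"
    using z ab eq[OF z] by (simp add: vn_adj_adj[OF vn d] state_diff vn_compose[OF vn])
  then have "?z = 0" using state_faithful[OF z] by simp
  with vn_is_adj[OF vn d] have "is_adj (a - b) 0" by metis
  then have "blinfun_apply (a - b) \<xi> = 0" for \<xi>
    by - (rule cinner_eq_rightI, simp add: is_adj_def blinfun.zero_left)
  then show ?thesis by (intro blinfun_eqI) (simp add: blinfun.diff_left)
qed

end


section \<open>Spectral measures\<close>

context
  fixes E :: "real set \<Rightarrow> ('k::chilbert_space) op"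
  assumes E: "projection_valued_measure E"
begin

lemma pvm_bounded_ops: "A \<in> sets borel \<Longrightarrow> E A \<in> bounded_ops"
  and pvm_is_adj: "A \<in> sets borel \<Longrightarrow> is_adj (E A) (E A)"
  and pvm_UNIV: "E UNIV = id_blinfun"
  using E by (auto simp: projection_valued_measure_def)

lemma pvm_Int:
  assumes "A \<in> sets borel" "B \<in> sets borel"
  shows "blinfun_apply (E A) (blinfun_apply (E B) \<xi>) = blinfun_apply (E (A \<inter> B)) \<xi>"
  using E assms by (auto simp: projection_valued_measure_def)

lemma pvm_sums:
  assumes "range A \<subseteq> sets borel" "disjoint_family A"
  shows "(\<lambda>n. blinfun_apply (E (A n)) \<xi>) sums blinfun_apply (E (\<Union>n. A n)) \<xi>"
  using E assms by (auto simp: projection_valued_measure_def)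

text \<open>Countable additivity along the constant sequence of empty sets yields a convergent
  series with constant terms.\<close>

lemma pvm_empty: "blinfun_apply (E {}) \<xi> = 0"
proof -
  have "summable (\<lambda>n :: nat. blinfun_apply (E {}) \<xi>)"
    using pvm_sums[of "\<lambda>_. {}" \<xi>] by (auto simp: disjoint_family_on_def sums_iff)
  then show ?thesis by (simp add: summable_const_iff)
qed

lemma pvm_Un:
  assumes AB: "A \<in> sets borel" "B \<in> sets borel" "A \<inter> B = {}"
  shows "blinfun_apply (E (A \<union> B)) \<xi> = blinfun_apply (E A) \<xi> + blinfun_apply (E B) \<xi>"
proof -
  let ?F = "\<lambda>n. blinfun_apply (E (binaryset A B n)) \<xi>"
  have "?F sums blinfun_apply (E (A \<union> B)) \<xi>"
  proof -
    have "disjoint_family (binaryset A B)"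
      using AB by (auto simp: disjoint_family_on_def binaryset_def)
    then show ?thesis
      using pvm_sums[of "binaryset A B" \<xi>] AB by (simp add: range_binaryset_eq UN_binaryset_eq)
  qed
  moreover have "?F sums (\<Sum>n\<in>{0, 1}. ?F n)"
    by (rule sums_finite) (auto simp: binaryset_def pvm_empty)
  ultimately show ?thesis
    using sums_unique2 by (fastforce simp: binaryset_def)
qed

lemma pvm_Compl:
  assumes "A \<in> sets borel"
  shows "blinfun_apply (E (- A)) \<xi> = \<xi> - blinfun_apply (E A) \<xi>"
  using pvm_Un[of A "- A" \<xi>] assms by (simp add: pvm_UNIV Compl_eq_Diff_UNIV algebra_simps)

lemma pvm_form:
  assumes "A \<in> sets borel"
  shows "cinner \<xi> (blinfun_apply (E A) \<xi>) = complex_of_real ((norm (blinfun_apply (E A) \<xi>))\<^sup>2)"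
  using assms pvm_Int[of A A \<xi>] is_adj_right[OF pvm_is_adj, of A \<xi> "blinfun_apply (E A) \<xi>"]
  by (simp add: cinner_self)

lemma space_spectral_measure [simp]: "space (spectral_measure E \<xi>) = UNIV"
  and sets_spectral_measure [measurable_cong]: "sets (spectral_measure E \<xi>) = sets borel"
  using sets.sigma_sets_eq[of "borel :: real measure"] by (simp_all add: spectral_measure_def)

text \<open>A measure built by \<open>measure_of\<close> takes the prescribed values only if they
  are countably additive. Here this is the strong additivity of \<open>E\<close>, carried through
  the continuous map \<open>cinner \<xi>\<close>.\<close>

lemma emeasure_spectral_measure:
  assumes A: "A \<in> sets borel"
  shows "emeasure (spectral_measure E \<xi>) A = ennreal ((norm (blinfun_apply (E A) \<xi>))\<^sup>2)"
proof -
  let ?\<mu> = "\<lambda>A. ennreal (Re (cinner \<xi> (blinfun_apply (E A) \<xi>)))"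
  have "emeasure (spectral_measure E \<xi>) A = ?\<mu> A"
  proof (rule emeasure_measure_of)
    show "spectral_measure E \<xi> = measure_of UNIV (sets borel) ?\<mu>"
      by (simp add: spectral_measure_def)
    show "A \<in> sets (spectral_measure E \<xi>)"
      using A by (simp add: sets_spectral_measure)
    show "positive (sets (spectral_measure E \<xi>)) ?\<mu>"
      by (simp add: positive_def pvm_empty)
    show "countably_additive (sets (spectral_measure E \<xi>)) ?\<mu>"
      unfolding sets_spectral_measure
    proof (rule countably_additiveI)
      fix B :: "nat \<Rightarrow> real set"
      assume B: "range B \<subseteq> sets borel" "disjoint_family B"
      then have Bn: "B n \<in> sets borel" for n by auto
      have "(\<lambda>n. Re (cinner \<xi> (blinfun_apply (E (B n)) \<xi>)))
          sums Re (cinner \<xi> (blinfun_apply (E (\<Union>n. B n)) \<xi>))"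
        by (intro bounded_linear.sums[OF bounded_linear_Re]
            bounded_linear.sums[OF bounded_bilinear.bounded_linear_right[OF bounded_bilinear_cinner]]
            pvm_sums B)
      then show "(\<Sum>n. ?\<mu> (B n)) = ?\<mu> (\<Union>n. B n)"
        by (intro suminf_ennreal_eq) (simp_all add: pvm_form Bn)
    qed
  qed (simp)
  then show ?thesis by (simp add: pvm_form A)
qed

lemma finite_measure_spectral_measure: "finite_measure (spectral_measure E \<xi>)"
  by (rule finite_measureI) (simp add: emeasure_spectral_measure)

text \<open>Since \<open>E B\<close> after \<open>E A\<close> is the projection of the intersection,
  projecting the vector restricts its spectral measure to \<open>A\<close>.\<close>

lemma spectral_measure_cutoff:
  assumes A: "A \<in> sets borel"
  shows "spectral_measure E (blinfun_apply (E A) \<xi>)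
    = density (spectral_measure E \<xi>) (\<lambda>l. ennreal (indicator A l))"
proof (rule measure_eqI)
  fix B assume "B \<in> sets (spectral_measure E (blinfun_apply (E A) \<xi>))"
  then have B: "B \<in> sets borel" by (simp add: sets_spectral_measure)
  show "emeasure (spectral_measure E (blinfun_apply (E A) \<xi>)) B
    = emeasure (density (spectral_measure E \<xi>) (\<lambda>l. ennreal (indicator A l))) B"
    using A B
    by (simp add: emeasure_spectral_measure pvm_Int ennreal_indicator emeasure_density
        indicator_inter_arith[symmetric] sets_spectral_measure Int_commute)
qed (simp add: sets_spectral_measure)

lemma integral_spectral_measure_cutoff:
  fixes f :: "real \<Rightarrow> complex"
  assumes "A \<in> sets borel" "f \<in> borel_measurable borel"
  shows "integral\<^sup>L (spectral_measure E (blinfun_apply (E A) \<xi>)) f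
    = (\<integral>l. indicator A l *\<^sub>R f l \<partial>spectral_measure E \<xi>)"
  using assms unfolding spectral_measure_cutoff[OF assms(1)]
  by (intro integral_density) (simp_all cong: measurable_cong_sets add: sets_spectral_measure)

section \<open>Spectral integrals and their quadratic forms\<close>

lemma is_spectral_integral_form:
  assumes "is_spectral_integral E f T" "(\<xi>, \<zeta>) \<in> T"
  shows "cinner \<xi> \<zeta> = integral\<^sup>L (spectral_measure E \<xi>) f"
  using assms by (auto simp: is_spectral_integral_def)

text \<open>The domain is given by square integrability, and on a finite measure
  \<open>1 + (cmod (f l))\<^sup>2\<close> is an integrable majorant.\<close>

lemma is_spectral_integral_integrable:
  assumes T: "is_spectral_integral E f T" "(\<xi>, \<zeta>) \<in> T" and f: "f \<in> borel_measurable borel"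
  shows "integrable (spectral_measure E \<xi>) f"
proof (rule Bochner_Integration.integrable_bound)
  interpret finite_measure "spectral_measure E \<xi>"
    by (rule finite_measure_spectral_measure)
  have "\<xi> \<in> Domain T" using T(2) by blast
  then have "integrable (spectral_measure E \<xi>) (\<lambda>l. (cmod (f l))\<^sup>2)"
    using T(1) by (simp add: is_spectral_integral_def)
  then show "integrable (spectral_measure E \<xi>) (\<lambda>l. 1 + (cmod (f l))\<^sup>2)"
    by simp
  show "f \<in> borel_measurable (spectral_measure E \<xi>)"
    using f by (simp cong: measurable_cong_sets add: sets_spectral_measure)
  have "cmod (f l) \<le> 1 + (cmod (f l))\<^sup>2" for l
    using sum_squares_bound[of 1 "cmod (f l)"] norm_ge_zero[of "f l"] by (simp del: norm_ge_zero)
  then show "AE l in spectral_measure E \<xi>. norm (f l) \<le> norm (1 + (cmod (f l))\<^sup>2)"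
    by (intro AE_I2) (simp add: abs_of_nonneg)
qed

lemma is_spectral_integral_Domain_cutoff:
  assumes T: "is_spectral_integral E f T" and f: "f \<in> borel_measurable borel"
    and A: "A \<in> sets borel" and \<xi>: "\<xi> \<in> Domain T"
  shows "blinfun_apply (E A) \<xi> \<in> Domain T"
proof -
  have i: "integrable (spectral_measure E \<xi>) (\<lambda>l. (cmod (f l))\<^sup>2)"
    using T \<xi> by (simp add: is_spectral_integral_def)
  have "integrable (spectral_measure E (blinfun_apply (E A) \<xi>)) (\<lambda>l. (cmod (f l))\<^sup>2)"
    unfolding spectral_measure_cutoff[OF A]
    using A f i integrable_mult_indicator[of A "spectral_measure E \<xi>" "\<lambda>l. (cmod (f l))\<^sup>2"]
    by (subst integrable_density)
      (auto cong: measurable_cong_sets simp: sets_spectral_measure)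
  then show ?thesis using T by (simp add: is_spectral_integral_def)
qed

text \<open>The quadratic form \<open>\<xi> \<mapsto> \<integral> f d\<mu>\<^sub>\<xi>\<close> is additive on orthogonal spectral subspaces, so
  polarization kills the off-diagonal blocks of \<open>T\<close>.\<close>

lemma spectral_integral_block_diagonal:
  assumes T: "is_spectral_integral E f T" and f: "f \<in> borel_measurable borel"
    and add: "\<And>x x' y y'. (x, x') \<in> T \<Longrightarrow> (y, y') \<in> T \<Longrightarrow> (x + y, x' + y') \<in> T"
    and scale: "\<And>c x x'. (x, x') \<in> T \<Longrightarrow> (c *\<^sub>C x, c *\<^sub>C x') \<in> T"
    and A: "A \<in> sets borel"
    and p: "(p, p') \<in> T" "blinfun_apply (E A) p = p"
    and q: "(q, q') \<in> T" "blinfun_apply (E A) q = 0"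
  shows "cinner p q' = 0" and "cinner q p' = 0"
proof -
  have "c * cinner p q' + cnj c * cinner q p' = 0" for c
  proof -
    let ?z = "p + c *\<^sub>C q" and ?z' = "p' + c *\<^sub>C q'"
    have cq: "(c *\<^sub>C q, c *\<^sub>C q') \<in> T" using q(1) by (rule scale)
    have z: "(?z, ?z') \<in> T" using p(1) cq by (rule add)
    \<comment> \<open>The projections of \<open>A\<close> and its complement split \<open>?z\<close>
      into \<open>p\<close> and \<open>c *\<^sub>C q\<close>, so the form at \<open>?z\<close> is
      the sum of the forms at these two.\<close>
    have EA: "blinfun_apply (E A) ?z = p"
      using p(2) q(2)
      by (simp add: blinfun.add_right bounded_ops_apply[OF pvm_bounded_ops[OF A]] scaleC_zero_right)
    have EA': "blinfun_apply (E (- A)) ?z = c *\<^sub>C q"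
      by (simp add: pvm_Compl[OF A] EA)
    note i = is_spectral_integral_integrable[OF T z f]
    have "cinner p p' + cinner (c *\<^sub>C q) (c *\<^sub>C q')
      = (\<integral>l. indicator A l *\<^sub>R f l \<partial>spectral_measure E ?z)
        + (\<integral>l. indicator (- A) l *\<^sub>R f l \<partial>spectral_measure E ?z)"
      unfolding is_spectral_integral_form[OF T p(1)] is_spectral_integral_form[OF T cq]
      using integral_spectral_measure_cutoff[OF A f, of ?z]
        integral_spectral_measure_cutoff[OF _ f, of "- A" ?z] A
      by (simp add: EA EA')
    also have "\<dots> = (\<integral>l. indicator A l *\<^sub>R f l + indicator (- A) l *\<^sub>R f l \<partial>spectral_measure E ?z)"
      using A i by (intro Bochner_Integration.integral_add[symmetric] integrable_mult_indicator)
        (simp_all add: sets_spectral_measure)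
    also have "\<dots> = integral\<^sup>L (spectral_measure E ?z) f"
      by (intro Bochner_Integration.integral_cong) (auto simp: indicator_def)
    also have "\<dots> = cinner ?z ?z'"
      by (rule is_spectral_integral_form[OF T z, symmetric])
    finally have "cinner ?z ?z' = cinner p p' + cinner (c *\<^sub>C q) (c *\<^sub>C q')" by simp
    then show ?thesis by (simp add: cinner_simps algebra_simps)
  qed
  then show "cinner p q' = 0" "cinner q p' = 0"
    by (rule polarization_eq_0)+
qed

text \<open>As \<open>T\<close> fixes \<open>\<xi>\<close> and is block-diagonal for the spectral
  subspaces, the integral of \<open>l - 1\<close> over every Borel set vanishes. Hence the spectral
  measure of \<open>\<xi>\<close> is concentrated at \<open>1\<close>.\<close>

lemma spectral_integral_fixed_vector:
  assumes T: "is_spectral_integral E complex_of_real T"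
    and add: "\<And>x x' y y'. (x, x') \<in> T \<Longrightarrow> (y, y') \<in> T \<Longrightarrow> (x + y, x' + y') \<in> T"
    and scale: "\<And>c x x'. (x, x') \<in> T \<Longrightarrow> (c *\<^sub>C x, c *\<^sub>C x') \<in> T"
    and \<xi>: "(\<xi>, \<xi>) \<in> T"
  shows "blinfun_apply (E {1}) \<xi> = \<xi>"
proof -
  let ?\<mu> = "spectral_measure E \<xi>"
  interpret finite_measure ?\<mu> by (rule finite_measure_spectral_measure)
  have f: "complex_of_real \<in> borel_measurable borel" by simp
  have int1: "integrable ?\<mu> (\<lambda>l. l)"
    using is_spectral_integral_integrable[OF T \<xi> f] by (simp add: complex_of_real_integrable_eq)
  have int: "integrable ?\<mu> (\<lambda>l. indicator A l * (l - 1))" if "A \<in> sets borel" for A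
    using that int1 integrable_mult_indicator[of A ?\<mu> "\<lambda>l. l - 1"]
    by (simp add: sets_spectral_measure)
  \<comment> \<open>Block-diagonality replaces \<open>cinner ?p \<xi>\<close> by
    \<open>cinner ?p p'\<close>. The former is the measure of \<open>A\<close>, the latter the
    integral of \<open>l\<close> over \<open>A\<close>.\<close>
  have zero: "(\<integral>l. indicator A l * (l - 1) \<partial>?\<mu>) = 0" if A: "A \<in> sets borel" for A
  proof -
    let ?p = "blinfun_apply (E A) \<xi>"
    obtain p' where p': "(?p, p') \<in> T"
      using is_spectral_integral_Domain_cutoff[OF T f A] \<xi> by blast
    have "(\<xi> + (- 1) *\<^sub>C ?p, \<xi> + (- 1) *\<^sub>C p') \<in> T"
      using \<xi> p' by (intro add scale)
    then have q: "(\<xi> - ?p, \<xi> - p') \<in> T" by (simp add: scaleC_minus1)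
    have "cinner ?p (\<xi> - p') = 0"
      using spectral_integral_block_diagonal(1)[OF T f add scale A p' _ q]
      by (simp add: blinfun.diff_right pvm_Int[OF A A])
    then have "cinner ?p \<xi> = cinner ?p p'" by (simp add: cinner_simps)
    also have "\<dots> = (\<integral>l. indicator A l *\<^sub>R complex_of_real l \<partial>?\<mu>)"
      using is_spectral_integral_form[OF T p'] integral_spectral_measure_cutoff[OF A f] by simp
    also have "\<dots> = complex_of_real (\<integral>l. indicator A l * l \<partial>?\<mu>)"
      by (simp add: scaleR_conv_of_real flip: of_real_mult)
    finally have "cinner ?p \<xi> = complex_of_real (\<integral>l. indicator A l * l \<partial>?\<mu>)" .
    moreover have "cinner ?p \<xi> = complex_of_real ((norm ?p)\<^sup>2)"
      using pvm_form[OF A] pvm_is_adj[OF A] by (metis is_adj_right)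
    ultimately have "(norm ?p)\<^sup>2 = (\<integral>l. indicator A l * l \<partial>?\<mu>)"
      using of_real_eq_iff by metis
    moreover have "(norm ?p)\<^sup>2 = (\<integral>l. indicator A l \<partial>?\<mu>)"
      using A emeasure_spectral_measure[OF A, of \<xi>]
      by (simp add: measure_def sets_spectral_measure)
    moreover have "integrable ?\<mu> (\<lambda>l. indicator A l * l)"
      using A int1 integrable_mult_indicator[of A ?\<mu> "\<lambda>l. l"]
      by (simp add: sets_spectral_measure)
    moreover have "integrable ?\<mu> (indicator A :: real \<Rightarrow> real)"
      using A by (intro integrable_real_indicator) (simp_all add: sets_spectral_measure emeasure_spectral_measure)
    ultimately show ?thesis
      by (simp add: right_diff_distrib)
  qed
  \<comment> \<open>On each side of \<open>1\<close> the integrand has constant sign, so a vanishing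
    integral makes it zero almost everywhere.\<close>
  have "AE l in ?\<mu>. indicator {1<..} l * (l - 1) = 0"
    by (rule iffD1[OF integral_nonneg_eq_0_iff_AE[OF int] zero]) (auto simp: indicator_def)
  moreover have "AE l in ?\<mu>. - (indicator {..<1} l * (l - 1)) = 0"
    by (rule iffD1[OF integral_nonneg_eq_0_iff_AE[OF Bochner_Integration.integrable_minus[OF int]]])
      (use zero[of "{..<1}"] in \<open>auto simp: indicator_def\<close>)
  ultimately have "AE l in ?\<mu>. l \<notin> - {1}"
    by eventually_elim (auto simp: indicator_def split: if_splits)
  then have "emeasure ?\<mu> (- {1}) = 0"
    by (subst (asm) AE_iff_measurable[where N = "- {1}"]) (auto simp: sets_spectral_measure)
  then have "blinfun_apply (E (- {1})) \<xi> = 0"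
    by (simp add: emeasure_spectral_measure)
  then show ?thesis by (simp add: pvm_Compl)
qed

text \<open>On the range of \<open>E {1}\<close> the integral sees only the value
  \<open>f 1 = 1\<close>, so the form of \<open>U\<close> is the squared norm there. Polarization
  and block-diagonality extend this to all matrix coefficients involving \<open>\<omega>\<close>.
  The second conclusion serves for \<open>U\<close> next to the left slot of the inner
  product.\<close>

lemma spectral_integral_on_fixed_vector:
  assumes U: "is_spectral_integral E f {(\<xi>, blinfun_apply U \<xi>) | \<xi>. True}"
    and f: "f \<in> borel_measurable borel" "f 1 = 1" and bd: "U \<in> bounded_ops"
    and \<omega>: "blinfun_apply (E {1}) \<omega> = \<omega>"
  shows "blinfun_apply U \<omega> = \<omega>" and "cinner \<omega> (blinfun_apply U \<xi>) = cinner \<omega> \<xi>"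
proof -
  let ?P = "blinfun_apply (E {1})" and ?U = "blinfun_apply U"
  have P: "{1} \<in> sets (borel :: real measure)" by simp
  have block: "cinner \<omega> (?U (\<xi> - ?P \<xi>)) = 0" "cinner (\<xi> - ?P \<xi>) (?U \<omega>) = 0" for \<xi>
  proof -
    have "?P (\<xi> - ?P \<xi>) = 0" by (simp add: blinfun.diff_right pvm_Int[OF P P])
    then show "cinner \<omega> (?U (\<xi> - ?P \<xi>)) = 0" "cinner (\<xi> - ?P \<xi>) (?U \<omega>) = 0"
      using spectral_integral_block_diagonal[OF U f(1) _ _ P _ \<omega>, of "?U \<omega>" "\<xi> - ?P \<xi>" "?U (\<xi> - ?P \<xi>)"]
      by (auto simp: blinfun.add_right bounded_ops_apply[OF bd])
  qed
  have form: "cinner p (?U p) = cinner p p" if p: "?P p = p" for p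
  proof -
    have "cinner p (?U p) = integral\<^sup>L (spectral_measure E (?P p)) f"
      using is_spectral_integral_form[OF U, of p "?U p"] by (auto simp: p)
    also have "\<dots> = (\<integral>l. indicator {1} l *\<^sub>R f l \<partial>spectral_measure E p)"
      by (rule integral_spectral_measure_cutoff[OF P f(1)])
    also have "\<dots> = (\<integral>l. complex_of_real (indicator {1} l) \<partial>spectral_measure E p)"
      using f(2) by (intro Bochner_Integration.integral_cong) (auto simp: indicator_def)
    also have "\<dots> = complex_of_real ((norm (?P p))\<^sup>2)"
      using emeasure_spectral_measure[OF P, of p]
      by (simp add: measure_def sets_spectral_measure)
    finally show ?thesis by (simp add: p cinner_self)
  qed
  have fixed: "cinner p (?U \<omega>) = cinner p \<omega>" "cinner \<omega> (?U p) = cinner \<omega> p" if p: "?P p = p" for p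
  proof -
    have "c * (cinner p (?U \<omega>) - cinner p \<omega>) + cnj c * (cinner \<omega> (?U p) - cinner \<omega> p) = 0" for c
    proof -
      have "?P (p + c *\<^sub>C \<omega>) = p + c *\<^sub>C \<omega>"
        by (simp add: blinfun.add_right bounded_ops_apply[OF pvm_bounded_ops[OF P]] p \<omega>)
      from form[OF this] form[OF \<omega>] form[OF p] show ?thesis
        by (simp add: blinfun.add_right bounded_ops_apply[OF bd] cinner_simps algebra_simps)
    qed
    from polarization_eq_0[OF this]
    show "cinner p (?U \<omega>) = cinner p \<omega>" "cinner \<omega> (?U p) = cinner \<omega> p" by simp_all
  qed
  have PP: "?P (?P \<xi>) = ?P \<xi>" for \<xi> by (simp add: pvm_Int[OF P P])
  have P\<omega>: "cinner (?P \<xi>) \<omega> = cinner \<xi> \<omega>" "cinner \<omega> (?P \<xi>) = cinner \<omega> \<xi>" for \<xi>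
    using is_adj_right[OF pvm_is_adj[OF P]] by (metis \<omega>)+
  show "?U \<omega> = \<omega>"
    by (rule cinner_eq_rightI) (use block(2) fixed(1)[OF PP] P\<omega> in \<open>simp add: cinner_simps\<close>)
  show "cinner \<omega> (?U \<xi>) = cinner \<omega> \<xi>"
    using block(1)[of \<xi>] fixed(2)[OF PP[of \<xi>]] P\<omega>(2)[of \<xi>]
    by (simp add: blinfun.diff_right cinner_simps)
qed

end


section \<open>Invariance of a state under its modular group\<close>

lemma closure_pair_addI:
  fixes G :: "('a::real_normed_vector \<times> 'a) set"
  assumes "\<And>x x' y y'. (x, x') \<in> G \<Longrightarrow> (y, y') \<in> G \<Longrightarrow> (x + y, x' + y') \<in> G"
    and "(x, x') \<in> closure G" "(y, y') \<in> closure G"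
  shows "(x + y, x' + y') \<in> closure G"
proof -
  obtain f g where f: "\<forall>n. f n \<in> G" "f \<longlonglongrightarrow> (x, x')" and g: "\<forall>n. g n \<in> G" "g \<longlonglongrightarrow> (y, y')"
    using assms(2,3) unfolding closure_sequential by blast
  have "f n + g n \<in> G" for n
    using assms(1)[of "fst (f n)" "snd (f n)" "fst (g n)" "snd (g n)"] f(1) g(1)
    by (simp add: plus_prod_def)
  moreover have "(\<lambda>n. f n + g n) \<longlonglongrightarrow> (x + y, x' + y')"
    using tendsto_add[OF f(2) g(2)] by simp
  ultimately show ?thesis
    unfolding closure_sequential by (intro exI[of _ "\<lambda>n. f n + g n"]) simp
qed

lemma closure_pair_scaleCI:
  fixes G :: "('a::chilbert_space \<times> 'a) set"
  assumes "\<And>x x'. (x, x') \<in> G \<Longrightarrow> (c *\<^sub>C x, d *\<^sub>C x') \<in> G" and "(x, x') \<in> closure G"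
  shows "(c *\<^sub>C x, d *\<^sub>C x') \<in> closure G"
proof -
  obtain f where f: "\<forall>n. f n \<in> G" "f \<longlonglongrightarrow> (x, x')"
    using assms(2) unfolding closure_sequential by blast
  have "(c *\<^sub>C fst (f n), d *\<^sub>C snd (f n)) \<in> G" for n
    using assms(1)[of "fst (f n)" "snd (f n)"] f(1) by simp
  moreover have "(\<lambda>n. (c *\<^sub>C fst (f n), d *\<^sub>C snd (f n))) \<longlonglongrightarrow> (c *\<^sub>C x, d *\<^sub>C x')"
    using tendsto_fst[OF f(2)] tendsto_snd[OF f(2)]
    by (intro tendsto_Pair bounded_linear.tendsto[OF bounded_linear_scaleC]) simp_all
  ultimately show ?thesis
    unfolding closure_sequential by (intro exI[of _ "\<lambda>n. (c *\<^sub>C fst (f n), d *\<^sub>C snd (f n))"]) simp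
qed

lemma automorphism_action_star_hom:
  assumes "automorphism_action N \<alpha>"
  shows "star_hom N N (\<alpha> g)"
  using assms by (simp add: automorphism_action_def)

lemma star_hom_closed:
  assumes "star_hom N M \<Phi>" "x \<in> N"
  shows "\<Phi> x \<in> M"
  using assms by (auto simp: star_hom_def linear_map_on_def)

lemma automorphism_action_minus:
  assumes "automorphism_action N \<alpha>" "x \<in> N"
  shows "\<alpha> g (\<alpha> (- g) x) = x"
proof -
  have "\<alpha> (g + - g) x = \<alpha> g (\<alpha> (- g) x)" "\<alpha> 0 x = x"
    using assms unfolding automorphism_action_def by blast+
  then show ?thesis by simp
qed

context normal_state
begin

text \<open>The polarization arguments for spectral integrals require a linear graph. For the
  modular operator this starts here, from the algebra, and passes to the closure.\<close>

lemma tomita_operator_add: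
  assumes "(x, x') \<in> tomita_operator N \<pi> \<Omega>" "(y, y') \<in> tomita_operator N \<pi> \<Omega>"
  shows "(x + y, x' + y') \<in> tomita_operator N \<pi> \<Omega>"
  using _ assms unfolding tomita_operator_def
proof (rule closure_pair_addI)
  let ?G = "{(blinfun_apply (\<pi> x) \<Omega>, blinfun_apply (\<pi> (adj x)) \<Omega>) | x. x \<in> N}"
  fix x x' y y' assume "(x, x') \<in> ?G" "(y, y') \<in> ?G"
  then obtain a b where ab: "a \<in> N" "b \<in> N"
    and eq: "x = blinfun_apply (\<pi> a) \<Omega>" "x' = blinfun_apply (\<pi> (adj a)) \<Omega>"
      "y = blinfun_apply (\<pi> b) \<Omega>" "y' = blinfun_apply (\<pi> (adj b)) \<Omega>"
    by blast
  have "is_adj (a + b) (adj a + adj b)"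
    using vn_is_adj[OF vn ab(1)] vn_is_adj[OF vn ab(2)]
    by (simp add: is_adj_def blinfun.add_left cinner_simps)
  then have "adj (a + b) = adj a + adj b" by (rule adj_eq)
  moreover have "\<pi> (s + t) = \<pi> s + \<pi> t" if "s \<in> N" "t \<in> N" for s t
    using gns_hom that by (simp add: star_hom_def linear_map_on_def)
  ultimately show "(x + y, x' + y') \<in> ?G"
    using ab vn_add[OF vn ab] vn_adj[OF vn]
    by (intro CollectI exI[of _ "a + b"]) (simp add: eq blinfun.add_left)
qed

lemma tomita_operator_scaleC:
  assumes "(x, x') \<in> tomita_operator N \<pi> \<Omega>"
  shows "(c *\<^sub>C x, cnj c *\<^sub>C x') \<in> tomita_operator N \<pi> \<Omega>"
  using _ assms unfolding tomita_operator_def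
proof (rule closure_pair_scaleCI)
  let ?G = "{(blinfun_apply (\<pi> x) \<Omega>, blinfun_apply (\<pi> (adj x)) \<Omega>) | x. x \<in> N}"
  fix x x' assume "(x, x') \<in> ?G"
  then obtain a where a: "a \<in> N"
    and eq: "x = blinfun_apply (\<pi> a) \<Omega>" "x' = blinfun_apply (\<pi> (adj a)) \<Omega>"
    by blast
  have "is_adj (scaleC_op c a) (scaleC_op (cnj c) (adj a))"
    using vn_is_adj[OF vn a] by (simp add: is_adj_def cinner_simps)
  then have "adj (scaleC_op c a) = scaleC_op (cnj c) (adj a)" by (rule adj_eq)
  moreover have "\<pi> (scaleC_op d s) = scaleC_op d (\<pi> s)" if "s \<in> N" for d s
    using gns_hom that by (simp add: star_hom_def linear_map_on_def)
  ultimately show "(c *\<^sub>C x, cnj c *\<^sub>C x') \<in> ?G"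
    using a vn_scaleC[OF vn a] vn_adj[OF vn a]
    by (intro CollectI exI[of _ "scaleC_op c a"]) (simp add: eq)
qed

lemma modular_operator_add:
  assumes "(x, x') \<in> modular_operator N \<pi> \<Omega>" "(y, y') \<in> modular_operator N \<pi> \<Omega>"
  shows "(x + y, x' + y') \<in> modular_operator N \<pi> \<Omega>"
proof -
  let ?S = "tomita_operator N \<pi> \<Omega>"
  obtain u v where u: "(x, u) \<in> ?S" "(u, x') \<in> antilinear_adjoint ?S"
    and v: "(y, v) \<in> ?S" "(v, y') \<in> antilinear_adjoint ?S"
    using assms by (auto simp: modular_operator_def)
  have "(u + v, x' + y') \<in> antilinear_adjoint ?S"
    using u(2) v(2) by (fastforce simp: antilinear_adjoint_def cinner_simps)
  then show ?thesis
    using tomita_operator_add[OF u(1) v(1)] by (auto simp: modular_operator_def)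
qed

text \<open>The Tomita operator conjugates the scalar and its antilinear adjoint conjugates it
  back.\<close>

lemma modular_operator_scaleC:
  assumes "(x, x') \<in> modular_operator N \<pi> \<Omega>"
  shows "(c *\<^sub>C x, c *\<^sub>C x') \<in> modular_operator N \<pi> \<Omega>"
proof -
  let ?S = "tomita_operator N \<pi> \<Omega>"
  obtain u where u: "(x, u) \<in> ?S" "(u, x') \<in> antilinear_adjoint ?S"
    using assms by (auto simp: modular_operator_def)
  have "(cnj c *\<^sub>C u, c *\<^sub>C x') \<in> antilinear_adjoint ?S"
    using u(2) by (fastforce simp: antilinear_adjoint_def cinner_simps)
  then show ?thesis
    using tomita_operator_scaleC[OF u(1)] by (auto simp: modular_operator_def)
qed

text \<open>The Tomita operator fixes \<open>\<Omega>\<close> because the unit is self-adjoint. Its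
  adjoint does so because the required identity holds on the vectors \<open>\<pi> x \<Omega>\<close>
  and extends to the closure by continuity.\<close>

lemma modular_operator_gns_vec: "(\<Omega>, \<Omega>) \<in> modular_operator N \<pi> \<Omega>"
proof -
  let ?G = "{(blinfun_apply (\<pi> x) \<Omega>, blinfun_apply (\<pi> (adj x)) \<Omega>) | x. x \<in> N}"
  have "(\<Omega>, \<Omega>) \<in> ?G"
    using vn_id[OF vn] by (intro CollectI exI[of _ id_blinfun]) (simp add: gns_id adj_eq[OF is_adj_id])
  then have S: "(\<Omega>, \<Omega>) \<in> tomita_operator N \<pi> \<Omega>"
    unfolding tomita_operator_def by (rule subsetD[OF closure_subset])
  have "closed {p. cinner (snd p) \<Omega> = cinner \<Omega> (fst p)}"
    by (intro closed_Collect_eq) (rule bounded_bilinear.continuous_on[OF bounded_bilinear_cinner];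
        intro continuous_intros)+
  moreover have "?G \<subseteq> {p. cinner (snd p) \<Omega> = cinner \<Omega> (fst p)}"
    using gns_is_adj by (auto simp: is_adj_def)
  ultimately have "tomita_operator N \<pi> \<Omega> \<subseteq> {p. cinner (snd p) \<Omega> = cinner \<Omega> (fst p)}"
    unfolding tomita_operator_def by (intro closure_minimal)
  then have "(\<Omega>, \<Omega>) \<in> antilinear_adjoint (tomita_operator N \<pi> \<Omega>)"
    by (auto simp: antilinear_adjoint_def)
  with S show ?thesis by (auto simp: modular_operator_def)
qed

text \<open>In \<open>cinner \<Omega> (\<pi> (\<sigma> t x) \<Omega>)\<close> the factors
  \<open>U t\<close> and \<open>U (- t)\<close> are absorbed by the copy of \<open>\<Omega>\<close>
  on their side.\<close>

lemma state_modular_invariant: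
  assumes \<sigma>: "modular_automorphism_group N \<pi> \<Omega> \<sigma>" and x: "x \<in> N"
  shows "\<rho> (\<sigma> t x) = \<rho> x"
proof -
  obtain E U where E: "projection_valued_measure E"
    and \<Delta>: "is_spectral_integral E complex_of_real (modular_operator N \<pi> \<Omega>)"
    and bd: "\<And>t. U t \<in> bounded_ops"
    and U: "\<And>t. is_spectral_integral E (\<lambda>l. cis (t * ln l)) {(\<xi>, blinfun_apply (U t) \<xi>) | \<xi>. True}"
    and \<pi>\<sigma>: "\<And>t x. x \<in> N \<Longrightarrow> \<pi> (\<sigma> t x) = U t o\<^sub>L \<pi> x o\<^sub>L U (- t)"
    using \<sigma> unfolding modular_automorphism_group_def by blast
  have \<Omega>: "blinfun_apply (E {1}) \<Omega> = \<Omega>"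
    using spectral_integral_fixed_vector[OF E \<Delta> modular_operator_add modular_operator_scaleC
        modular_operator_gns_vec] .
  have meas: "(\<lambda>l. cis (t * ln l)) \<in> borel_measurable borel" for t
    by (intro measurable_compose[OF _ borel_measurable_continuous_onI[of cis]] continuous_intros) simp
  \<comment> \<open>The premise left open, that the function is 1 at \<open>l = 1\<close>, holds
    because \<open>ln 1 = 0\<close>.\<close>
  note fixed = spectral_integral_on_fixed_vector[OF E U meas _ bd \<Omega>]
  have "\<sigma> t x \<in> N"
    using \<sigma> x by (auto simp: modular_automorphism_group_def
        intro: star_hom_closed[OF automorphism_action_star_hom])
  then show ?thesis
    using x by (simp add: state_gns \<pi>\<sigma> fixed)
qed

end


section \<open>Adjoint maps\<close>

text \<open>Group actions are left out of the data, so that a single equivariance lemma with a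
  polymorphic group serves both the modular groups and the actions of G.\<close>

locale adjoint_maps = N: normal_state N \<rho> \<pi> \<Omega> + M: normal_state M \<phi> \<pi>' \<Omega>'
  for N :: "('h::chilbert_space) op set" and \<rho> and \<pi> :: "'h op \<Rightarrow> ('k::chilbert_space) op" and \<Omega>
    and M :: "('h2::chilbert_space) op set" and \<phi> and \<pi>' :: "'h2 op \<Rightarrow> ('k2::chilbert_space) op" and \<Omega>' +
  fixes \<Phi> :: "'h op \<Rightarrow> 'h2 op" and \<Psi> :: "'h2 op \<Rightarrow> 'h op"
  assumes \<Phi>: "normal_ucp N M \<Phi>" and \<Psi>: "normal_ucp M N \<Psi>"
    and adjoint: "x \<in> N \<Longrightarrow> y \<in> M \<Longrightarrow> \<rho> (\<Psi> y o\<^sub>L x) = \<phi> (y o\<^sub>L \<Phi> x)"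
begin

lemma linear: "linear_map_on N M \<Phi>" "linear_map_on M N \<Psi>"
  and unital: "\<Phi> id_blinfun = id_blinfun" "\<Psi> id_blinfun = id_blinfun"
  and cp: "completely_positive N \<Phi>" "completely_positive M \<Psi>"
  using \<Phi> \<Psi> by (auto simp: normal_ucp_def)

lemma closed: "x \<in> N \<Longrightarrow> \<Phi> x \<in> M" "y \<in> M \<Longrightarrow> \<Psi> y \<in> N"
  using linear by (auto simp: linear_map_on_def)

lemma bounded: "N \<subseteq> bounded_ops" "M \<subseteq> bounded_ops"
  using vn_bounded_ops[OF N.vn] vn_bounded_ops[OF M.vn] by auto

lemma is_adj_maps: "x \<in> N \<Longrightarrow> is_adj (\<Phi> x) (\<Phi> (adj x))" "y \<in> M \<Longrightarrow> is_adj (\<Psi> y) (\<Psi> (adj y))"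
  using ucp_is_adj[OF N.vn linear(1) unital(1) cp(1) _ bounded(2)]
    ucp_is_adj[OF M.vn linear(2) unital(2) cp(2) _ bounded(1)] by auto

lemma state_adjoint_map:
  assumes "y \<in> M"
  shows "\<rho> (\<Psi> y) = \<phi> y"
proof -
  have "\<Psi> y o\<^sub>L id_blinfun = \<Psi> y" "y o\<^sub>L id_blinfun = y"
    by (rule blinfun_eqI, simp)+
  then show ?thesis
    using adjoint[OF vn_id[OF N.vn] assms] by (simp add: unital)
qed

text \<open>Taking adjoints in the defining relation reverses the products. The result is the
  relation that makes \<open>\<Phi>\<close> the adjoint of \<open>\<Psi>\<close>.\<close>

lemma adjoint_left:
  assumes x: "x \<in> N" and y: "y \<in> M"
  shows "\<phi> (\<Phi> x o\<^sub>L y) = \<rho> (x o\<^sub>L \<Psi> y)"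
proof -
  have x': "adj x \<in> N" and y': "adj y \<in> M"
    using x y vn_adj[OF N.vn] vn_adj[OF M.vn] by auto
  have "adj (adj y o\<^sub>L \<Phi> (adj x)) = \<Phi> x o\<^sub>L y"
    using is_adj_compose[OF vn_is_adj[OF M.vn y'] is_adj_maps(1)[OF x']]
    by (simp add: adj_eq vn_adj_adj[OF N.vn x] vn_adj_adj[OF M.vn y])
  then have "\<phi> (\<Phi> x o\<^sub>L y) = cnj (\<phi> (adj y o\<^sub>L \<Phi> (adj x)))"
    using M.state_adj[OF vn_compose[OF M.vn y' closed(1)[OF x']]] by simp
  also have "\<dots> = cnj (\<rho> (\<Psi> (adj y) o\<^sub>L adj x))"
    by (simp add: adjoint[OF x' y'])
  also have "\<dots> = \<rho> (adj (\<Psi> (adj y) o\<^sub>L adj x))"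
    by (rule N.state_adj[OF vn_compose[OF N.vn closed(2)[OF y'] x'], symmetric])
  also have "adj (\<Psi> (adj y) o\<^sub>L adj x) = x o\<^sub>L \<Psi> y"
    using is_adj_compose[OF is_adj_maps(2)[OF y'] vn_is_adj[OF N.vn x']]
    by (simp add: adj_eq vn_adj_adj[OF N.vn x] vn_adj_adj[OF M.vn y])
  finally show ?thesis .
qed

lemma adjoint_map_equivariant:
  assumes \<alpha>: "automorphism_action N \<alpha>" and \<beta>: "automorphism_action M \<beta>"
    and \<rho>\<alpha>: "\<And>x. x \<in> N \<Longrightarrow> \<rho> (\<alpha> g x) = \<rho> x" and \<phi>\<beta>: "\<And>y. y \<in> M \<Longrightarrow> \<phi> (\<beta> g y) = \<phi> y"
    and \<Phi>\<alpha>: "\<And>g x. x \<in> N \<Longrightarrow> \<beta> g (\<Phi> x) = \<Phi> (\<alpha> g x)"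
    and y: "y \<in> M"
  shows "\<alpha> g (\<Psi> y) = \<Psi> (\<beta> g y)"
proof (rule N.state_separating)
  note \<alpha>N = star_hom_closed[OF automorphism_action_star_hom[OF \<alpha>]]
  note \<beta>M = star_hom_closed[OF automorphism_action_star_hom[OF \<beta>]]
  have mult: "\<alpha> g (a o\<^sub>L b) = \<alpha> g a o\<^sub>L \<alpha> g b" if "a \<in> N" "b \<in> N" for a b
    using automorphism_action_star_hom[OF \<alpha>, of g] that by (simp add: star_hom_def)
  have mult': "\<beta> g (a o\<^sub>L b) = \<beta> g a o\<^sub>L \<beta> g b" if "a \<in> M" "b \<in> M" for a b
    using automorphism_action_star_hom[OF \<beta>, of g] that by (simp add: star_hom_def)
  show "\<alpha> g (\<Psi> y) \<in> N" "\<Psi> (\<beta> g y) \<in> N"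
    using y by (simp_all add: \<alpha>N \<beta>M closed)
  fix x assume x: "x \<in> N"
  \<comment> \<open>Writing \<open>x\<close> as \<open>\<alpha> g z\<close> lets
    \<open>\<alpha> g\<close> be pulled out of the product and absorbed by the invariant
    state.\<close>
  define z where "z = \<alpha> (- g) x"
  have z: "z \<in> N" "\<alpha> g z = x"
    using x automorphism_action_minus[OF \<alpha> x] by (simp_all add: z_def \<alpha>N)
  have "\<rho> (\<alpha> g (\<Psi> y) o\<^sub>L x) = \<rho> (\<alpha> g (\<Psi> y o\<^sub>L z))"
    using y z by (simp add: mult closed)
  also have "\<dots> = \<phi> (y o\<^sub>L \<Phi> z)"
    using y z(1) by (simp add: \<rho>\<alpha> vn_compose[OF N.vn] closed adjoint)
  also have "\<dots> = \<phi> (\<beta> g (y o\<^sub>L \<Phi> z))"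
    using y z(1) by (simp add: \<phi>\<beta> vn_compose[OF M.vn] closed)
  also have "\<dots> = \<phi> (\<beta> g y o\<^sub>L \<Phi> x)"
    using y z by (simp add: mult' closed \<Phi>\<alpha>)
  also have "\<dots> = \<rho> (\<Psi> (\<beta> g y) o\<^sub>L x)"
    using x y by (simp add: adjoint \<beta>M)
  finally show "\<rho> (\<alpha> g (\<Psi> y) o\<^sub>L x) = \<rho> (\<Psi> (\<beta> g y) o\<^sub>L x)" .
qed

text \<open>If a contraction of Hilbert spaces maps \<open>n\<close> to a vector \<open>m\<close> of the same length, its adjoint
  maps \<open>m\<close> back to \<open>n\<close>; the Kadison--Schwarz inequality provides the contraction property.\<close>

lemma adjoint_map_isometric:
  assumes n: "n \<in> N" and eq: "\<phi> (adj (\<Phi> n) o\<^sub>L \<Phi> n) = \<rho> (adj n o\<^sub>L n)"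
  shows "\<Psi> (\<Phi> n) = n"
proof -
  define m where "m = \<Phi> n"
  define d where "d = \<Psi> m - n"
  have m: "m \<in> M" and m': "adj m \<in> M" and n': "adj n \<in> N" and mm: "adj m o\<^sub>L m \<in> M"
    and \<Psi>m: "\<Psi> m \<in> N" and \<Psi>m': "\<Psi> (adj m) \<in> N"
    using n by (simp_all add: m_def closed vn_adj[OF N.vn] vn_adj[OF M.vn] vn_compose[OF M.vn])
  have d: "d \<in> N" unfolding d_def using \<Psi>m n by (rule vn_diff[OF N.vn])
  have "adj d = \<Psi> (adj m) - adj n"
    unfolding d_def by (rule adj_eq[OF is_adj_diff[OF is_adj_maps(2)[OF m] vn_is_adj[OF N.vn n]]])
  \<comment> \<open>The squared length of \<open>\<Psi> m - n\<close> is expanded. Below,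
    \<open>c1\<close> and \<open>c2\<close> evaluate the cross terms by the adjoint relation, and
    \<open>c3\<close> bounds the first term by Kadison-Schwarz and preservation of the
    states.\<close>
  then have "adj d o\<^sub>L d = ((\<Psi> (adj m) o\<^sub>L \<Psi> m) - (\<Psi> (adj m) o\<^sub>L n)) - ((adj n o\<^sub>L \<Psi> m) - (adj n o\<^sub>L n))"
    unfolding d_def by (intro blinfun_eqI) (simp add: blinfun.diff_left blinfun.diff_right)
  then have expand: "\<rho> (adj d o\<^sub>L d)
      = (\<rho> (\<Psi> (adj m) o\<^sub>L \<Psi> m) - \<rho> (\<Psi> (adj m) o\<^sub>L n)) - (\<rho> (adj n o\<^sub>L \<Psi> m) - \<rho> (adj n o\<^sub>L n))"
    using n n' \<Psi>m \<Psi>m' by (simp add: N.state_diff vn_diff[OF N.vn] vn_compose[OF N.vn])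
  have c1: "\<rho> (\<Psi> (adj m) o\<^sub>L n) = \<phi> (adj m o\<^sub>L m)"
    using adjoint[OF n m'] by (simp add: m_def)
  have "adj (\<Psi> (adj m) o\<^sub>L n) = adj n o\<^sub>L \<Psi> m"
    using is_adj_compose[OF is_adj_maps(2)[OF m'] vn_is_adj[OF N.vn n]]
    by (simp add: adj_eq vn_adj_adj[OF M.vn m])
  then have c2: "\<rho> (adj n o\<^sub>L \<Psi> m) = cnj (\<phi> (adj m o\<^sub>L m))"
    using N.state_adj[OF vn_compose[OF N.vn \<Psi>m' n]] c1 by simp
  have "0 \<le> Re (\<rho> (\<Psi> (adj m o\<^sub>L m) - (\<Psi> (adj m) o\<^sub>L \<Psi> m)))"
    using Kadison_Schwarz[OF M.vn linear(2) unital(2) cp(2) m bounded(1)] \<Psi>m \<Psi>m' mm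
    by (intro N.state_positive vn_diff[OF N.vn] vn_compose[OF N.vn]) (simp_all add: closed)
  then have c3: "Re (\<rho> (\<Psi> (adj m) o\<^sub>L \<Psi> m)) \<le> Re (\<phi> (adj m o\<^sub>L m))"
    using \<Psi>m \<Psi>m' mm
    by (simp add: N.state_diff closed vn_compose[OF N.vn] state_adjoint_map)
  have "Re (\<rho> (adj d o\<^sub>L d)) \<le> 0"
    unfolding expand c1 c2 using c3 eq by (simp add: m_def)
  then have "d = 0" by (rule N.state_faithful[OF d])
  then show ?thesis by (simp add: d_def m_def)
qed

end

section \<open>Joinings of dynamical systems relative to a common subsystem\<close>

lemma wstar_dynamical_system_normal_state:
  assumes "wstar_dynamical_system \<NN>"
  shows "normal_state (alg \<NN>) (state \<NN>) (gns_rep \<NN>) (gns_vec \<NN>)"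
  using assms by (simp add: wstar_dynamical_system_def normal_state_def)

lemma is_adjoint_map_adjoint_maps:
  assumes "wstar_dynamical_system \<NN>" "wstar_dynamical_system \<MM>"
    and "\<Phi> \<in> J\<^sub>m \<NN> \<MM>" "is_adjoint_map \<NN> \<MM> \<Phi> \<Psi>"
  shows "adjoint_maps (alg \<NN>) (state \<NN>) (gns_rep \<NN>) (gns_vec \<NN>)
    (alg \<MM>) (state \<MM>) (gns_rep \<MM>) (gns_vec \<MM>) \<Phi> \<Psi>"
  using assms
  by (intro adjoint_maps.intro wstar_dynamical_system_normal_state)
    (auto simp: adjoint_maps_axioms_def joinings_def is_adjoint_map_def)

lemma is_adjoint_map_sym:
  assumes "wstar_dynamical_system \<NN>" "wstar_dynamical_system \<MM>"
    and "\<Phi> \<in> J\<^sub>m \<NN> \<MM>" "is_adjoint_map \<NN> \<MM> \<Phi> \<Psi>"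
  shows "is_adjoint_map \<MM> \<NN> \<Psi> \<Phi>"
proof -
  interpret adjoint_maps "alg \<NN>" "state \<NN>" "gns_rep \<NN>" "gns_vec \<NN>"
    "alg \<MM>" "state \<MM>" "gns_rep \<MM>" "gns_vec \<MM>" \<Phi> \<Psi>
    by (rule is_adjoint_map_adjoint_maps[OF assms])
  show ?thesis by (simp add: is_adjoint_map_def \<Phi> adjoint_left)
qed

text \<open>Equivariance is applied twice. For the modular groups the states are invariant by
  \<open>state_modular_invariant\<close>, for the actions by the definition of a system.\<close>

lemma is_adjoint_map_joinings:
  assumes NN: "wstar_dynamical_system \<NN>" and MM: "wstar_dynamical_system \<MM>"
    and \<Phi>J: "\<Phi> \<in> J\<^sub>m \<NN> \<MM>" and adj: "is_adjoint_map \<NN> \<MM> \<Phi> \<Psi>"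
  shows "\<Psi> \<in> J\<^sub>m \<MM> \<NN>"
proof -
  interpret adjoint_maps "alg \<NN>" "state \<NN>" "gns_rep \<NN>" "gns_vec \<NN>"
    "alg \<MM>" "state \<MM>" "gns_rep \<MM>" "gns_vec \<MM>" \<Phi> \<Psi>
    by (rule is_adjoint_map_adjoint_maps[OF assms])
  have modN: "modular_automorphism_group (alg \<NN>) (gns_rep \<NN>) (gns_vec \<NN>) (modular \<NN>)"
    and modM: "modular_automorphism_group (alg \<MM>) (gns_rep \<MM>) (gns_vec \<MM>) (modular \<MM>)"
    using NN MM by (auto simp: wstar_dynamical_system_def)
  have "modular \<NN> t (\<Psi> y) = \<Psi> (modular \<MM> t y)" if "y \<in> alg \<MM>" for t y
  proof (rule adjoint_map_equivariant[where \<alpha> = "modular \<NN>" and \<beta> = "modular \<MM>", OF _ _ _ _ _ that])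
    show "automorphism_action (alg \<NN>) (modular \<NN>)" "automorphism_action (alg \<MM>) (modular \<MM>)"
      using modN modM by (auto simp: modular_automorphism_group_def)
  qed (use \<Phi>J in \<open>simp_all add: joinings_def N.state_modular_invariant[OF modN]
      M.state_modular_invariant[OF modM]\<close>)
  moreover have "act \<NN> g (\<Psi> y) = \<Psi> (act \<MM> g y)" if "y \<in> alg \<MM>" for g y
    by (rule adjoint_map_equivariant[where \<alpha> = "act \<NN>" and \<beta> = "act \<MM>", OF _ _ _ _ _ that])
      (use NN MM \<Phi>J in \<open>simp_all add: wstar_dynamical_system_def joinings_def\<close>)
  ultimately show ?thesis
    by (simp add: joinings_def \<Psi> state_adjoint_map)
qed

text \<open>Injectivity cancels \<open>inv_into\<close>. Indexed by \<open>alg \<BB>\<close>, the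
  restriction conditions for a map and its adjoint can be compared directly.\<close>

lemma joinings_over_iff:
  assumes "inj_on \<iota>\<^sub>N (alg \<BB>)"
  shows "\<Phi> \<in> joinings_over \<BB> \<iota>\<^sub>N \<iota>\<^sub>M \<NN> \<MM> \<longleftrightarrow>
    \<Phi> \<in> J\<^sub>m \<NN> \<MM> \<and> (\<forall>b\<in>alg \<BB>. \<Phi> (\<iota>\<^sub>N b) = \<iota>\<^sub>M b)"
  using assms by (simp add: joinings_over_def)

text \<open>An embedding respects products, adjoints and states, hence the lengths that the states
  define.\<close>

lemma subsystem_embedding_state:
  assumes BB: "wstar_dynamical_system \<BB>" and \<iota>: "subsystem_embedding \<BB> \<NN> \<iota>" and b: "b \<in> alg \<BB>"
  shows "\<iota> b \<in> alg \<NN>" and "state \<NN> (adj (\<iota> b) o\<^sub>L \<iota> b) = state \<BB> (adj b o\<^sub>L b)"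
proof -
  have vn: "von_neumann_algebra (alg \<BB>)"
    using BB by (simp add: wstar_dynamical_system_def)
  have hom: "star_hom (alg \<BB>) (alg \<NN>) \<iota>" and J: "\<iota> \<in> J\<^sub>m \<BB> \<NN>"
    using \<iota> by (simp_all add: subsystem_embedding_def)
  show "\<iota> b \<in> alg \<NN>" by (rule star_hom_closed[OF hom b])
  have b': "adj b \<in> alg \<BB>" by (rule vn_adj[OF vn b])
  have "adj (\<iota> b) o\<^sub>L \<iota> b = \<iota> (adj b o\<^sub>L b)"
    using hom b b' adj_eq[of "\<iota> b" "\<iota> (adj b)"] by (simp add: star_hom_def)
  then show "state \<NN> (adj (\<iota> b) o\<^sub>L \<iota> b) = state \<BB> (adj b o\<^sub>L b)"
    using J vn_compose[OF vn b' b] by (simp add: joinings_def)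
qed

lemma adjoint_map_joinings_over:
  assumes NN: "wstar_dynamical_system \<NN>" and MM: "wstar_dynamical_system \<MM>"
    and BB: "common_subsystem \<BB> \<iota>\<^sub>N \<iota>\<^sub>M \<NN> \<MM>"
    and adj: "is_adjoint_map \<NN> \<MM> \<Phi> \<Psi>"
    and \<Phi>: "\<Phi> \<in> joinings_over \<BB> \<iota>\<^sub>N \<iota>\<^sub>M \<NN> \<MM>"
  shows "\<Psi> \<in> joinings_over \<BB> \<iota>\<^sub>M \<iota>\<^sub>N \<MM> \<NN>"
proof -
  have B: "wstar_dynamical_system \<BB>"
    and emb: "subsystem_embedding \<BB> \<NN> \<iota>\<^sub>N" "subsystem_embedding \<BB> \<MM> \<iota>\<^sub>M"
    using BB by (auto simp: common_subsystem_def)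
  then have inj: "inj_on \<iota>\<^sub>N (alg \<BB>)" "inj_on \<iota>\<^sub>M (alg \<BB>)"
    by (auto simp: subsystem_embedding_def)
  have \<Phi>J: "\<Phi> \<in> J\<^sub>m \<NN> \<MM>" and \<Phi>\<iota>: "\<And>b. b \<in> alg \<BB> \<Longrightarrow> \<Phi> (\<iota>\<^sub>N b) = \<iota>\<^sub>M b"
    using \<Phi> by (auto simp: joinings_over_iff inj)
  interpret adjoint_maps "alg \<NN>" "state \<NN>" "gns_rep \<NN>" "gns_vec \<NN>"
    "alg \<MM>" "state \<MM>" "gns_rep \<MM>" "gns_vec \<MM>" \<Phi> \<Psi>
    by (rule is_adjoint_map_adjoint_maps[OF NN MM \<Phi>J adj])
  \<comment> \<open>Both images of \<open>b\<close> have the length of \<open>b\<close> in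
    \<open>\<BB>\<close>, which is the hypothesis of \<open>adjoint_map_isometric\<close>.\<close>
  have "\<Psi> (\<iota>\<^sub>M b) = \<iota>\<^sub>N b" if b: "b \<in> alg \<BB>" for b
    using adjoint_map_isometric[of "\<iota>\<^sub>N b"] subsystem_embedding_state[OF B emb(1) b]
      subsystem_embedding_state[OF B emb(2) b] by (simp add: \<Phi>\<iota> b)
  then show ?thesis
    using is_adjoint_map_joinings[OF NN MM \<Phi>J adj] by (simp add: joinings_over_iff inj)
qed

theorem proposition2p8:
  fixes \<NN> :: "('h::chilbert_space, 'k::chilbert_space, 'g::{topological_group_add, t2_space}) wstar_system"
    and \<MM> :: "('h2::chilbert_space, 'k2::chilbert_space, 'g) wstar_system"
    and \<BB> :: "('b::chilbert_space, 'c::chilbert_space, 'g) wstar_system"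
    and \<iota>\<^sub>N :: "'b op \<Rightarrow> 'h op" and \<iota>\<^sub>M :: "'b op \<Rightarrow> 'h2 op"
    and \<Phi> :: "'h op \<Rightarrow> 'h2 op" and \<Phi>\<^sub>a\<^sub>d\<^sub>j :: "'h2 op \<Rightarrow> 'h op"
  assumes "wstar_dynamical_system \<NN>" and "wstar_dynamical_system \<MM>"
    and "common_subsystem \<BB> \<iota>\<^sub>N \<iota>\<^sub>M \<NN> \<MM>"
    and "\<Phi> \<in> J\<^sub>m \<NN> \<MM>"
    and "is_adjoint_map \<NN> \<MM> \<Phi> \<Phi>\<^sub>a\<^sub>d\<^sub>j"
  shows "\<Phi> \<in> joinings_over \<BB> \<iota>\<^sub>N \<iota>\<^sub>M \<NN> \<MM> \<longleftrightarrow>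
         \<Phi>\<^sub>a\<^sub>d\<^sub>j \<in> joinings_over \<BB> \<iota>\<^sub>M \<iota>\<^sub>N \<MM> \<NN>"
proof
  assume "\<Phi> \<in> joinings_over \<BB> \<iota>\<^sub>N \<iota>\<^sub>M \<NN> \<MM>"
  then show "\<Phi>\<^sub>a\<^sub>d\<^sub>j \<in> joinings_over \<BB> \<iota>\<^sub>M \<iota>\<^sub>N \<MM> \<NN>"
    by (rule adjoint_map_joinings_over[OF assms(1-3,5)])
next
  \<comment> \<open>The converse is the first direction with the two systems exchanged, since the
    common subsystem and the adjoint relation are both symmetric.\<close>
  have "common_subsystem \<BB> \<iota>\<^sub>M \<iota>\<^sub>N \<MM> \<NN>"
    using assms(3) by (simp add: common_subsystem_def)
  moreover assume "\<Phi>\<^sub>a\<^sub>d\<^sub>j \<in> joinings_over \<BB> \<iota>\<^sub>M \<iota>\<^sub>N \<MM> \<NN>"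
  ultimately show "\<Phi> \<in> joinings_over \<BB> \<iota>\<^sub>N \<iota>\<^sub>M \<NN> \<MM>"
    using is_adjoint_map_sym[OF assms(1,2,4,5)] by (intro adjoint_map_joinings_over[OF assms(2,1)])
qed

end
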